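(* Let $(A,m,1,*,\Delta,\varepsilon,S)$ be a finite C$^*$-quantum groupoid and let $k$ be the positive invertible element of $A_t$ with $k^2=1_{(2)}S(1_{(1)})$. Define, for $a\in A$, $$\tilde\Delta(a)=(1\otimes k^{-1})\Delta(a)(1\otimes k^{-1}),\quad \tilde\varepsilon(a)=\varepsilon(kaS(k))=\varepsilon(S(k)ak),\quad \tilde S(a)=S(k^{-1})\,k\,S(a)\,k^{-1}\,S(k).$$ Then $(A,m,1,*,\tilde\Delta,\tilde\varepsilon,\tilde S)$ is a finite C$^*$-quantum groupoid which is regular (its antipode is involutive on its counital subalgebras); these are exactly the coalgebra structures dual, with respect to the deformed pairing $[a,b]=\langle kaS(k),b\rangle$, to the algebra structure of the dual $B$. Consequently any pair of dual finite C$^*$-quantum groupoids can be deformed into a pair of dual regular finite C$^*$-quantum groupoids without changing the C$^*$-algebra structures.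
   Context: Finite C$^*$-quantum groupoid: a finite-dimensional C$^*$-algebra $G$ (product $m$, unit $1$, involution $*$) with coassociative $*$-homomorphic coproduct $\Delta$ satisfying $(\Delta\otimes\mathrm{id})\Delta(1)=(1\otimes\Delta(1))(\Delta(1)\otimes1)$, counit $\varepsilon$ with $\varepsilon(fgh)=\varepsilon(fg_{(1)})\varepsilon(g_{(2)}h)$, antipode $S$ (algebra and coalgebra anti-homomorphism) with $m(\mathrm{id}\otimes S)\Delta(g)=(\varepsilon\otimes\mathrm{id})(\Delta(1)(g\otimes1))$; Sweedler notation $\Delta(x)=x_{(1)}\otimes x_{(2)}$, $\Delta(1)=1_{(1)}\otimes1_{(2)}$. Counital subalgebras: $A_t=\varepsilon_t(A)$, $A_s=\varepsilon_s(A)$ with $\varepsilon_t(g)=(\varepsilon\otimes\mathrm{id})(\Delta(1)(g\otimes1))$, $\varepsilon_s(g)=(\mathrm{id}\otimes\varepsilon)((1\otimes g)\Delta(1))$. Regular: $S^2$ is the identity on $A_t$ and $A_s$. $B$ is the dual quantum groupoid with pairing $\langle\cdot,\cdot\rangle$ satisfying $\langle a,bc\rangle=\langle\Delta(a),b\otimes c\rangle$. The element $1_{(2)}S(1_{(1)})$ is known to be a positive invertible element of $A_t$; $k$ is its positive square root. *)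

theory Defs
  imports Complex_Main
begin

text \<open>A finite-dimensional complex vector space with a chosen basis indexed by a
finite type 'i is represented as the coordinate space 'i => complex.
The tensor product of the spaces indexed by 'a and 'b is the coordinate space
indexed by 'a * 'b; the elementary tensor of x and y is tens x y.\<close>

type_synonym 'i vec = "'i \<Rightarrow> complex"

definition vzero :: "'i vec" where "vzero = (\<lambda>_. 0)"
definition vadd :: "'i vec \<Rightarrow> 'i vec \<Rightarrow> 'i vec" where "vadd x y = (\<lambda>i. x i + y i)"
definition smul :: "complex \<Rightarrow> 'i vec \<Rightarrow> 'i vec" where "smul c x = (\<lambda>i. c * x i)"
definition bas :: "'i \<Rightarrow> 'i vec" where "bas i = (\<lambda>j. if j = i then 1 else 0)"
definition vsum :: "('a \<Rightarrow> 'i vec) \<Rightarrow> 'a set \<Rightarrow> 'i vec" where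
  "vsum F S = (\<lambda>j. \<Sum>a\<in>S. F a j)"

definition lin_map :: "('a vec \<Rightarrow> 'b vec) \<Rightarrow> bool" where
  "lin_map f \<longleftrightarrow> (\<forall>x y. f (vadd x y) = vadd (f x) (f y)) \<and> (\<forall>c x. f (smul c x) = smul c (f x))"
definition lin_fun :: "('a vec \<Rightarrow> complex) \<Rightarrow> bool" where
  "lin_fun f \<longleftrightarrow> (\<forall>x y. f (vadd x y) = f x + f y) \<and> (\<forall>c x. f (smul c x) = c * f x)"

definition tens :: "'a vec \<Rightarrow> 'b vec \<Rightarrow> ('a \<times> 'b) vec" where
  "tens x y = (\<lambda>(i, j). x i * y j)"
definition tmap :: "('a vec \<Rightarrow> 'c vec) \<Rightarrow> ('b vec \<Rightarrow> 'd vec) \<Rightarrow> ('a \<times> 'b) vec \<Rightarrow> ('c \<times> 'd) vec" where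
  "tmap f g t = vsum (\<lambda>(i, j). smul (t (i, j)) (tens (f (bas i)) (g (bas j)))) UNIV"
definition tmult :: "('a vec \<Rightarrow> 'a vec \<Rightarrow> 'a vec) \<Rightarrow> ('b vec \<Rightarrow> 'b vec \<Rightarrow> 'b vec)
     \<Rightarrow> ('a \<times> 'b) vec \<Rightarrow> ('a \<times> 'b) vec \<Rightarrow> ('a \<times> 'b) vec" where
  "tmult m1 m2 t u = vsum (\<lambda>((i, j), (k, l)). smul (t (i, j) * u (k, l))
        (tens (m1 (bas i) (bas k)) (m2 (bas j) (bas l)))) UNIV"
definition tstar :: "('a vec \<Rightarrow> 'a vec) \<Rightarrow> ('b vec \<Rightarrow> 'b vec) \<Rightarrow> ('a \<times> 'b) vec \<Rightarrow> ('a \<times> 'b) vec" where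
  "tstar s1 s2 t = vsum (\<lambda>(i, j). smul (cnj (t (i, j))) (tens (s1 (bas i)) (s2 (bas j)))) UNIV"
definition tfun :: "('a vec \<Rightarrow> complex) \<Rightarrow> ('b vec \<Rightarrow> complex) \<Rightarrow> ('a \<times> 'b) vec \<Rightarrow> complex" where
  "tfun \<phi> \<psi> t = (\<Sum>(i, j)\<in>UNIV. t (i, j) * \<phi> (bas i) * \<psi> (bas j))"
definition tm :: "('a vec \<Rightarrow> 'a vec \<Rightarrow> 'a vec) \<Rightarrow> ('a \<times> 'a) vec \<Rightarrow> 'a vec" where
  "tm m t = vsum (\<lambda>(i, j). smul (t (i, j)) (m (bas i) (bas j))) UNIV"
definition slice_l :: "('a vec \<Rightarrow> complex) \<Rightarrow> ('a \<times> 'b) vec \<Rightarrow> 'b vec" where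
  "slice_l \<phi> t = vsum (\<lambda>(i, j). smul (t (i, j) * \<phi> (bas i)) (bas j)) UNIV"
definition slice_r :: "('b vec \<Rightarrow> complex) \<Rightarrow> ('a \<times> 'b) vec \<Rightarrow> 'a vec" where
  "slice_r \<phi> t = vsum (\<lambda>(i, j). smul (t (i, j) * \<phi> (bas j)) (bas i)) UNIV"
definition flip :: "('a \<times> 'b) vec \<Rightarrow> ('b \<times> 'a) vec" where
  "flip t = (\<lambda>(i, j). t (j, i))"
definition reassoc :: "(('a \<times> 'b) \<times> 'c) vec \<Rightarrow> ('a \<times> ('b \<times> 'c)) vec" where
  "reassoc t = (\<lambda>(i, (j, k)). t ((i, j), k))"

text \<open>Finite-dimensional C*-algebra: a unital associative complex *-algebra
admitting a C*-norm (completeness is automatic in finite dimension).\<close>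
definition cstar_alg :: "('i vec \<Rightarrow> 'i vec \<Rightarrow> 'i vec) \<Rightarrow> 'i vec \<Rightarrow> ('i vec \<Rightarrow> 'i vec) \<Rightarrow> bool" where
  "cstar_alg m u st \<longleftrightarrow>
     (\<forall>x. lin_map (m x)) \<and> (\<forall>y. lin_map (\<lambda>x. m x y)) \<and>
     (\<forall>x y z. m (m x y) z = m x (m y z)) \<and> (\<forall>x. m u x = x \<and> m x u = x) \<and>
     (\<forall>x y. st (vadd x y) = vadd (st x) (st y)) \<and> (\<forall>c x. st (smul c x) = smul (cnj c) (st x)) \<and>
     (\<forall>x. st (st x) = x) \<and> (\<forall>x y. st (m x y) = m (st y) (st x)) \<and>
     (\<exists>nrm :: 'i vec \<Rightarrow> real.
        (\<forall>x. nrm x = 0 \<longleftrightarrow> x = vzero) \<and>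
        (\<forall>c x. nrm (smul c x) = cmod c * nrm x) \<and>
        (\<forall>x y. nrm (vadd x y) \<le> nrm x + nrm y) \<and>
        (\<forall>x y. nrm (m x y) \<le> nrm x * nrm y) \<and>
        (\<forall>x. nrm (m (st x) x) = nrm x ^ 2))"

record 'i qgroupoid =
  qmul :: "'i vec \<Rightarrow> 'i vec \<Rightarrow> 'i vec"
  qunit :: "'i vec"
  qstar :: "'i vec \<Rightarrow> 'i vec"
  qcomul :: "'i vec \<Rightarrow> ('i \<times> 'i) vec"
  qcounit :: "'i vec \<Rightarrow> complex"
  qanti :: "'i vec \<Rightarrow> 'i vec"

definition eps_t :: "'i qgroupoid \<Rightarrow> 'i vec \<Rightarrow> 'i vec" where
  "eps_t G g = slice_l (qcounit G)
     (tmult (qmul G) (qmul G) (qcomul G (qunit G)) (tens g (qunit G)))"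
definition eps_s :: "'i qgroupoid \<Rightarrow> 'i vec \<Rightarrow> 'i vec" where
  "eps_s G g = slice_r (qcounit G)
     (tmult (qmul G) (qmul G) (tens (qunit G) g) (qcomul G (qunit G)))"

definition fin_cqg :: "'i qgroupoid \<Rightarrow> bool" where
  "fin_cqg G \<longleftrightarrow>
    (let m = qmul G; u = qunit G; st = qstar G; \<Delta> = qcomul G; \<epsilon> = qcounit G; S = qanti G in
     cstar_alg m u st \<and>
     \<comment> \<open>coassociative *-homomorphic coproduct\<close>
     lin_map \<Delta> \<and>
     (\<forall>a b. \<Delta> (m a b) = tmult m m (\<Delta> a) (\<Delta> b)) \<and>
     (\<forall>a. \<Delta> (st a) = tstar st st (\<Delta> a)) \<and>
     (\<forall>a. reassoc (tmap \<Delta> id (\<Delta> a)) = tmap id \<Delta> (\<Delta> a)) \<and>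
     \<comment> \<open>(Delta tensor id)Delta(1) = (1 tensor Delta(1))(Delta(1) tensor 1)\<close>
     reassoc (tmap \<Delta> id (\<Delta> u)) = tmult m (tmult m m) (tens u (\<Delta> u)) (reassoc (tens (\<Delta> u) u)) \<and>
     \<comment> \<open>counit\<close>
     lin_fun \<epsilon> \<and>
     (\<forall>a. slice_l \<epsilon> (\<Delta> a) = a \<and> slice_r \<epsilon> (\<Delta> a) = a) \<and>
     (\<forall>f g h. \<epsilon> (m f (m g h)) = tfun (\<lambda>x. \<epsilon> (m f x)) (\<lambda>y. \<epsilon> (m y h)) (\<Delta> g)) \<and>
     \<comment> \<open>antipode: algebra and coalgebra anti-homomorphism\<close>
     lin_map S \<and>
     (\<forall>a b. S (m a b) = m (S b) (S a)) \<and>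
     (\<forall>a. \<Delta> (S a) = flip (tmap S S (\<Delta> a))) \<and>
     (\<forall>a. \<epsilon> (S a) = \<epsilon> a) \<and>
     \<comment> \<open>m(id tensor S)Delta = eps_t\<close>
     (\<forall>g. tm m (tmap id S (\<Delta> g)) = eps_t G g))"

definition regular :: "'i qgroupoid \<Rightarrow> bool" where
  "regular G \<longleftrightarrow> (\<forall>x\<in>range (eps_t G). qanti G (qanti G x) = x) \<and>
                  (\<forall>x\<in>range (eps_s G). qanti G (qanti G x) = x)"

definition positive :: "'i qgroupoid \<Rightarrow> 'i vec \<Rightarrow> bool" where
  "positive G x \<longleftrightarrow> (\<exists>y. x = qmul G (qstar G y) y)"

definition ptens :: "('i vec \<Rightarrow> 'j vec \<Rightarrow> complex) \<Rightarrow> ('i \<times> 'i) vec \<Rightarrow> ('j \<times> 'j) vec \<Rightarrow> complex" where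
  "ptens p t s = (\<Sum>((i, j), (k, l))\<in>UNIV. t (i, j) * s (k, l) * p (bas i) (bas k) * p (bas j) (bas l))"

definition dual_pair :: "'i qgroupoid \<Rightarrow> 'j qgroupoid \<Rightarrow> ('i vec \<Rightarrow> 'j vec \<Rightarrow> complex) \<Rightarrow> bool" where
  "dual_pair A B p \<longleftrightarrow>
     (\<forall>b. lin_fun (\<lambda>a. p a b)) \<and> (\<forall>a. lin_fun (p a)) \<and>
     (\<forall>a. (\<forall>b. p a b = 0) \<longrightarrow> a = vzero) \<and> (\<forall>b. (\<forall>a. p a b = 0) \<longrightarrow> b = vzero) \<and>
     (\<forall>a b c. p a (qmul B b c) = ptens p (qcomul A a) (tens b c)) \<and>
     (\<forall>a a' b. p (qmul A a a') b = ptens p (tens a a') (qcomul B b)) \<and>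
     (\<forall>a. p a (qunit B) = qcounit A a) \<and> (\<forall>b. p (qunit A) b = qcounit B b) \<and>
     (\<forall>a b. p (qanti A a) b = p a (qanti B b)) \<and>
     (\<forall>a b. p a (qstar B b) = cnj (p (qstar A (qanti A a)) b))"

definition deform :: "'i qgroupoid \<Rightarrow> 'i vec \<Rightarrow> 'i vec \<Rightarrow> 'i qgroupoid" where
  "deform G k kinv =
    (let m = qmul G; u = qunit G; S = qanti G in
     G\<lparr> qcomul := (\<lambda>a. tmult m m (tmult m m (tens u kinv) (qcomul G a)) (tens u kinv)),
        qcounit := (\<lambda>a. qcounit G (m k (m a (S k)))),
        qanti := (\<lambda>a. m (S kinv) (m k (m (S a) (m kinv (S k))))) \<rparr>)"

end

theory Submission
  imports Defs
begin

text \<open>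
Write \<open>w = 1\<^sub>2 S(1\<^sub>1) = k\<^sup>2\<close>.  Since \<open>\<Delta>(1)\<close> lies in \<open>A\<^sub>s \<otimes> A\<^sub>t\<close>, elements of the
counital subalgebras can be moved across the legs of \<open>\<Delta>(1)\<close>:
\<open>(1 \<otimes> z) \<Delta>(1) = (S(z) \<otimes> 1) \<Delta>(1)\<close> for \<open>z \<in> A\<^sub>t\<close> and \<open>\<Delta>(1) (y \<otimes> 1) = \<Delta>(1) (1 \<otimes> S(y))\<close>
for \<open>y \<in> A\<^sub>s\<close>.  The first rule gives \<open>z w = w S\<^sup>2(z)\<close> on \<open>A\<^sub>t\<close>, that is, \<open>S\<^sup>2\<close> is implemented there by
\<open>w\<close>; in particular \<open>S\<^sup>2(k) = k\<close> and \<open>S(1\<^sub>1) w\<^sup>-\<^sup>1 1\<^sub>2 = 1\<close>.  The last identity says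
\<open>\<Delta>(1) (1 \<otimes> k\<^sup>-\<^sup>2) \<Delta>(1) = \<Delta>(1)\<close>, which makes the deformed coproduct multiplicative, and the conjugation by
\<open>k\<close> and \<open>S(k)\<close> in the deformed antipode cancels \<open>S\<^sup>2\<close> on the counital subalgebras.  For the duality,
\<open>z \<mapsto> \<epsilon>(z \<cdot>)\<close> identifies \<open>A\<^sub>t\<close> with \<open>B\<^sub>t\<close> and sends \<open>k\<close> to the corresponding element of \<open>B\<close>, so the
deformed pairing is symmetric in \<open>A\<close> and \<open>B\<close>.
\<close>

section \<open>Multilinear functionals and tensors\<close>

text \<open>Simp rules that discharge the linearity side conditions of Sweedler computations.
  Unfolding \<open>bilin\<close> and \<open>trilin\<close> reduces these conditions to one variable
  at a time.\<close>

named_theorems lin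

definition bilin :: "('a vec \<Rightarrow> 'b vec \<Rightarrow> complex) \<Rightarrow> bool" where
  [lin]: "bilin F \<longleftrightarrow> (\<forall>y. lin_fun (\<lambda>x. F x y)) \<and> (\<forall>x. lin_fun (F x))"

definition trilin :: "('a vec \<Rightarrow> 'b vec \<Rightarrow> 'c vec \<Rightarrow> complex) \<Rightarrow> bool" where
  [lin]: "trilin F \<longleftrightarrow> (\<forall>y z. lin_fun (\<lambda>x. F x y z)) \<and> (\<forall>x z. lin_fun (\<lambda>y. F x y z)) \<and> (\<forall>x y. lin_fun (F x y))"

text \<open>In Sweedler notation, \<open>sw (\<Delta> a) F\<close> is \<open>F(a\<^sub>1, a\<^sub>2)\<close>.\<close>
definition sw :: "('a \<times> 'b) vec \<Rightarrow> ('a vec \<Rightarrow> 'b vec \<Rightarrow> complex) \<Rightarrow> complex" where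
  "sw t F = (\<Sum>(i, j)\<in>UNIV. t (i, j) * F (bas i) (bas j))"

lemma bilinI: "(\<And>y. lin_fun (\<lambda>x. F x y)) \<Longrightarrow> (\<And>x. lin_fun (\<lambda>y. F x y)) \<Longrightarrow> bilin F"
  by (simp add: bilin_def)

lemma lin_map_id [lin]: "lin_map (\<lambda>x. x)"
  by (simp add: lin_map_def)

lemma lin_fun_comp: "lin_fun \<phi> \<Longrightarrow> lin_map f \<Longrightarrow> lin_fun (\<lambda>x. \<phi> (f x))"
  by (simp add: lin_map_def lin_fun_def)

lemma lin_map_comp: "lin_map g \<Longrightarrow> lin_map f \<Longrightarrow> lin_map (\<lambda>x. g (f x))"
  by (simp add: lin_map_def)

lemma bilin_comp1: "bilin F \<Longrightarrow> lin_map f \<Longrightarrow> lin_fun (\<lambda>x. F (f x) y)"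
  using lin_fun_comp[of "\<lambda>x. F x y" f] by (simp add: bilin_def)

lemma bilin_comp2: "bilin F \<Longrightarrow> lin_map f \<Longrightarrow> lin_fun (\<lambda>x. F y (f x))"
  using lin_fun_comp[of "F y" f] by (simp add: bilin_def)

lemma lin_fun_times [lin]:
  "lin_fun f \<Longrightarrow> lin_fun (\<lambda>x. c * f x)"
  "lin_fun f \<Longrightarrow> lin_fun (\<lambda>x. f x * c)"
  by (simp_all add: lin_fun_def algebra_simps)

lemma lin_fun_sw_arg [lin]:
  "(\<And>a b. lin_fun (\<lambda>x. F x a b)) \<Longrightarrow> lin_fun (\<lambda>x. sw t (\<lambda>a b. F x a b))"
  by (simp add: lin_fun_def sw_def algebra_simps sum.distrib sum_distrib_left case_prod_unfold)

lemma lin_fun_sw_tensor: "lin_fun (\<lambda>t. sw t F)"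
  by (simp add: lin_fun_def sw_def vadd_def smul_def algebra_simps sum.distrib sum_distrib_left case_prod_unfold)

lemma lin_fun_sw [lin]: "lin_map f \<Longrightarrow> lin_fun (\<lambda>x. sw (f x) F)"
  by (rule lin_fun_comp[OF lin_fun_sw_tensor])

lemma sw_times:
  "sw t (\<lambda>a b. c * F a b) = c * sw t F"
  "sw t (\<lambda>a b. F a b * c) = sw t F * c"
  by (simp_all add: sw_def sum_distrib_left sum_distrib_right case_prod_unfold mult_ac)

lemma sw_swap: "sw t (\<lambda>a b. sw u (\<lambda>c d. F a b c d)) = sw u (\<lambda>c d. sw t (\<lambda>a b. F a b c d))"
  unfolding sw_def case_prod_unfold sum_distrib_left
  by (subst sum.swap) (simp add: mult_ac)

lemma cnj_sw: "cnj (sw t F) = (\<Sum>(i, j)\<in>UNIV. cnj (t (i, j)) * cnj (F (bas i) (bas j)))"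
  by (simp add: sw_def case_prod_unfold)

section \<open>Coordinate expansions and separation by functionals\<close>

lemma lin_fun_vsum:
  assumes "lin_fun \<phi>"
  shows "finite S \<Longrightarrow> \<phi> (vsum f S) = (\<Sum>a\<in>S. \<phi> (f a))"
proof (induction S rule: finite_induct)
  case empty
  \<comment> \<open>The empty sum is the zero vector, written as a multiple by 0 so that homogeneity
    applies.\<close>
  have "\<phi> (smul 0 (vsum f {})) = 0" using assms by (simp add: lin_fun_def)
  then show ?case by (simp add: smul_def vsum_def)
next
  case (insert a S)
  have "vsum f (insert a S) = vadd (f a) (vsum f S)"
    using insert by (simp add: vsum_def vadd_def)
  then show ?case using insert assms by (simp add: lin_fun_def)
qed

lemma lin_fun_smul: "lin_fun \<phi> \<Longrightarrow> \<phi> (smul c x) = c * \<phi> x"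
  by (simp add: lin_fun_def)

lemma vec_expand: "(x :: ('i::finite) vec) = vsum (\<lambda>i. smul (x i) (bas i)) UNIV"
proof
  fix j
  have "(\<Sum>i\<in>UNIV. x i * (if j = i then 1 else 0)) = x j"
    by (simp add: if_distrib cong: if_cong)
  then show "x j = vsum (\<lambda>i. smul (x i) (bas i)) UNIV j"
    by (simp add: vsum_def smul_def bas_def)
qed

lemma lin_fun_expand:
  fixes x :: "('i::finite) vec"
  assumes "lin_fun \<phi>"
  shows "\<phi> x = (\<Sum>i\<in>UNIV. x i * \<phi> (bas i))"
proof -
  have "\<phi> x = \<phi> (vsum (\<lambda>i. smul (x i) (bas i)) UNIV)"
    by (rule arg_cong[OF vec_expand])
  also have "\<dots> = (\<Sum>i\<in>UNIV. x i * \<phi> (bas i))"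
    by (simp add: lin_fun_vsum[OF assms] lin_fun_smul[OF assms])
  finally show ?thesis .
qed

lemma lin_fun_coord: "lin_fun (\<lambda>x. x i)"
  by (simp add: lin_fun_def vadd_def smul_def)

text \<open>Coordinates are linear functionals, so functionals separate vectors. Identities in the
  algebra are thereby tested by scalars, the form in which \<open>sw\<close> can express
  them.\<close>

lemma vec_eqI:
  assumes "\<And>\<phi>. lin_fun \<phi> \<Longrightarrow> \<phi> x = \<phi> y"
  shows "x = y"
  by (rule ext) (rule assms[OF lin_fun_coord])

lemma sw_tens:
  fixes x :: "('i::finite) vec" and y :: "('j::finite) vec"
  assumes "bilin F"
  shows "sw (tens x y) F = F x y"
proof -
  have "F x y = (\<Sum>i\<in>UNIV. x i * F (bas i) y)"
    using assms lin_fun_expand[of "\<lambda>x. F x y" x] by (simp add: bilin_def)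
  also have "\<dots> = (\<Sum>i\<in>UNIV. x i * (\<Sum>j\<in>UNIV. y j * F (bas i) (bas j)))"
    using assms lin_fun_expand[of "F (bas _)" y] by (simp add: bilin_def)
  also have "\<dots> = sw (tens x y) F"
    by (simp add: sw_def tens_def sum_distrib_left mult_ac sum.cartesian_product UNIV_Times_UNIV[symmetric] del: UNIV_Times_UNIV)
  finally show ?thesis by simp
qed

lemma sw_coord: "sw t (\<lambda>x y. x i * y j) = t (i, j)" for t :: "('i::finite \<times> 'j::finite) vec"
proof -
  have "(bas i' :: 'i vec) i * (bas j' :: 'j vec) j = (bas (i', j') :: ('i \<times> 'j) vec) (i, j)" for i' j'
    by (simp add: bas_def)
  then have "sw t (\<lambda>x y. x i * y j) = (\<Sum>a\<in>UNIV. t a * bas a (i, j))"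
    by (simp add: sw_def case_prod_unfold)
  also have "\<dots> = t (i, j)"
    using lin_fun_expand[OF lin_fun_coord, of t "(i, j)"] by simp
  finally show ?thesis .
qed

text \<open>Products of two coordinate functionals are bilinear and read off every coefficient of a
  tensor, so bilinear forms separate tensors.\<close>

lemma tens_eqI:
  fixes t :: "('i::finite \<times> 'j::finite) vec"
  assumes "\<And>F. bilin F \<Longrightarrow> sw t F = sw u F"
  shows "t = u"
proof (rule ext)
  fix ij :: "'i \<times> 'j"
  have "bilin (\<lambda>(x :: 'i vec) (y :: 'j vec). x (fst ij) * y (snd ij))"
    by (intro bilinI lin_fun_times lin_fun_coord)
  from assms[OF this] show "t ij = u ij" by (simp add: sw_coord)
qed

section \<open>Tensor operations in Sweedler form\<close>

lemma sw_smul: "sw (smul c t) F = c * sw t F"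
  by (simp add: lin_fun_smul[OF lin_fun_sw_tensor])

lemma sw_vsum: "finite S \<Longrightarrow> sw (vsum f S) F = (\<Sum>a\<in>S. sw (f a) F)"
  by (rule lin_fun_vsum[OF lin_fun_sw_tensor])

lemma sw_tmap:
  fixes t :: "('a::finite \<times> 'b::finite) vec" and F :: "('c::finite) vec \<Rightarrow> ('d::finite) vec \<Rightarrow> complex"
  assumes "bilin F"
  shows "sw (tmap f g t) F = sw t (\<lambda>a b. F (f a) (g b))"
  unfolding tmap_def by (subst sw_vsum) (simp_all add: case_prod_unfold sw_smul sw_tens[OF assms] sw_def[of t])

lemma sw_tmult:
  fixes t u :: "('a::finite \<times> 'b::finite) vec"
  assumes "bilin F"
  shows "sw (tmult m1 m2 t u) F = sw t (\<lambda>a b. sw u (\<lambda>c d. F (m1 a c) (m2 b d)))"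
proof -
  have "sw (tmult m1 m2 t u) F = (\<Sum>x\<in>UNIV \<times> UNIV. t (fst x) * u (snd x) *
      F (m1 (bas (fst (fst x))) (bas (fst (snd x)))) (m2 (bas (snd (fst x))) (bas (snd (snd x)))))"
    unfolding tmult_def by (subst sw_vsum) (simp_all add: case_prod_unfold sw_smul sw_tens[OF assms])
  also have "\<dots> = sw t (\<lambda>a b. sw u (\<lambda>c d. F (m1 a c) (m2 b d)))"
    by (simp add: sw_def case_prod_unfold sum_distrib_left mult_ac sum.cartesian_product del: UNIV_Times_UNIV)
  finally show ?thesis .
qed

lemma sw_tstar:
  fixes t :: "('a::finite \<times> 'b::finite) vec"
  assumes "bilin F"
  shows "sw (tstar s1 s2 t) F = cnj (sw t (\<lambda>a b. cnj (F (s1 a) (s2 b))))"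
  unfolding tstar_def by (subst sw_vsum) (simp_all add: case_prod_unfold sw_smul sw_tens[OF assms] cnj_sw)

lemma tfun_sw: "tfun \<phi> \<psi> t = sw t (\<lambda>a b. \<phi> a * \<psi> b)"
  by (simp add: tfun_def sw_def mult_ac)

lemma lin_fun_tm:
  fixes t :: "('a::finite \<times> 'a) vec"
  assumes "lin_fun \<phi>"
  shows "\<phi> (tm m t) = sw t (\<lambda>a b. \<phi> (m a b))"
  unfolding tm_def
  by (subst lin_fun_vsum[OF assms]) (simp_all add: case_prod_unfold lin_fun_smul[OF assms] sw_def)

lemma lin_fun_slice_l:
  fixes t :: "('a::finite \<times> 'b::finite) vec"
  assumes "lin_fun \<phi>"
  shows "\<phi> (slice_l \<psi> t) = sw t (\<lambda>a b. \<psi> a * \<phi> b)"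
  unfolding slice_l_def
  by (subst lin_fun_vsum[OF assms]) (simp_all add: case_prod_unfold lin_fun_smul[OF assms] sw_def mult_ac)

lemma lin_fun_slice_r:
  fixes t :: "('a::finite \<times> 'b::finite) vec"
  assumes "lin_fun \<phi>"
  shows "\<phi> (slice_r \<psi> t) = sw t (\<lambda>a b. \<phi> a * \<psi> b)"
  unfolding slice_r_def
  by (subst lin_fun_vsum[OF assms]) (simp_all add: case_prod_unfold lin_fun_smul[OF assms] sw_def mult_ac)

lemma sw_flip:
  fixes t :: "('a::finite \<times> 'b::finite) vec"
  shows "sw (flip t) F = sw t (\<lambda>a b. F b a)"
  unfolding sw_def flip_def
  by (rule sum.reindex_bij_witness[of _ "\<lambda>(i, j). (j, i)" "\<lambda>(i, j). (j, i)"]) auto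

lemma sw_bas:
  assumes "bilin F"
  shows "sw (bas p) F = F (bas (fst p)) (bas (snd (p :: 'a::finite \<times> 'b::finite)))"
proof -
  have "bas p = tens (bas (fst p)) (bas (snd p))"
    by (cases p) (auto simp: bas_def tens_def)
  then show ?thesis by (simp only: sw_tens[OF assms])
qed

section \<open>Trilinear forms and triple tensors\<close>

lemma trilinI:
  "(\<And>y z. lin_fun (\<lambda>x. F x y z)) \<Longrightarrow> (\<And>x z. lin_fun (\<lambda>y. F x y z)) \<Longrightarrow> (\<And>x y. lin_fun (\<lambda>z. F x y z)) \<Longrightarrow> trilin F"
  by (simp add: trilin_def)

lemma trilin_comp1: "trilin F \<Longrightarrow> lin_map f \<Longrightarrow> lin_fun (\<lambda>x. F (f x) y z)"
  using lin_fun_comp[of "\<lambda>x. F x y z" f] by (simp add: trilin_def)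

lemma trilin_comp2: "trilin F \<Longrightarrow> lin_map f \<Longrightarrow> lin_fun (\<lambda>x. F y (f x) z)"
  using lin_fun_comp[of "\<lambda>x. F y x z" f] by (simp add: trilin_def)

lemma trilin_comp3: "trilin F \<Longrightarrow> lin_map f \<Longrightarrow> lin_fun (\<lambda>x. F y z (f x))"
  using lin_fun_comp[of "\<lambda>x. F y z x" f] by (simp add: trilin_def)

lemmas trilin_comp = trilin_comp1 trilin_comp2 trilin_comp3
lemmas bilin_comp = bilin_comp1 bilin_comp2

text \<open>Triple tensors are bracketed to the right, the bracketing that \<open>reassoc\<close>
  produces, so one evaluation serves both sides of coassociativity.\<close>

definition sw3 :: "('a \<times> ('b \<times> 'c)) vec \<Rightarrow> ('a vec \<Rightarrow> 'b vec \<Rightarrow> 'c vec \<Rightarrow> complex) \<Rightarrow> complex" where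
  "sw3 t F = sw t (\<lambda>x u. sw u (F x))"

lemma bilin_sw3: "trilin F \<Longrightarrow> bilin (\<lambda>x u. sw u (F x))"
  by (intro bilinI lin_fun_sw_tensor lin_fun_sw_arg) (simp add: trilin_def)

lemma sw3_eqI:
  fixes t :: "('a::finite \<times> ('b::finite \<times> 'c::finite)) vec"
  assumes "\<And>F. trilin F \<Longrightarrow> sw3 t F = sw3 u F"
  shows "t = u"
proof (rule ext)
  fix ij :: "'a \<times> 'b \<times> 'c"
  obtain i j k where ij: "ij = (i, j, k)" by (cases ij)
  have tri: "trilin (\<lambda>(x :: 'a vec) (y :: 'b vec) (z :: 'c vec). x i * (y j * z k))"
    by (intro trilinI lin_fun_times lin_fun_coord)
  have coord: "sw3 s (\<lambda>x y z. x i * (y j * z k)) = s (i, j, k)" for s :: "('a \<times> 'b \<times> 'c) vec"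
  proof -
    have "sw3 s (\<lambda>x y z. x i * (y j * z k)) = 
       (\<Sum>a\<in>UNIV. s a * sw (bas (snd a)) (\<lambda>y z. bas (fst a) i * (y j * z k)))"
      by (simp add: sw3_def sw_def[of s] case_prod_unfold)
    also have "\<dots> = (\<Sum>a\<in>UNIV. s a * bas a (i, j, k))"
      by (simp add: sw_bas bilinI lin_fun_times lin_fun_coord) (auto simp: bas_def prod_eq_iff intro!: sum.cong)
    also have "\<dots> = s (i, j, k)"
      using lin_fun_expand[OF lin_fun_coord, of s "(i, j, k)"] by simp
    finally show ?thesis .
  qed
  from assms[OF tri] show "t ij = u ij" by (simp add: coord ij)
qed

lemma sw3_reassoc:
  fixes t :: "(('a::finite \<times> 'b::finite) \<times> 'c::finite) vec"
  assumes F: "trilin F"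
  shows "sw3 (reassoc t) F = sw t (\<lambda>u z. sw u (\<lambda>x y. F x y z))"
proof -
  have "sw3 (reassoc t) F = (\<Sum>(i, j, k)\<in>UNIV. t ((i, j), k) * F (bas i) (bas j) (bas k))"
    unfolding sw3_def sw_def[of "reassoc t"]
    using F by (simp add: reassoc_def case_prod_unfold sw_bas bilinI trilin_def)
  also have "\<dots> = (\<Sum>((i, j), k)\<in>UNIV. t ((i, j), k) * F (bas i) (bas j) (bas k))"
    by (rule sum.reindex_bij_witness[of _ "\<lambda>((i, j), k). (i, j, k)" "\<lambda>(i, j, k). ((i, j), k)"]) auto
  also have "\<dots> = sw t (\<lambda>u z. sw u (\<lambda>x y. F x y z))"
    unfolding sw_def[of t]
    using F by (simp add: case_prod_unfold sw_bas bilinI trilin_def)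
  finally show ?thesis .
qed

text \<open>Together with \<open>sw3_coassoc_right\<close> this evaluates the two sides of
  coassociativity. The map \<open>f\<close> is left general because both the original and the
  deformed coproduct are inserted later.\<close>

lemma sw3_coassoc_left:
  fixes t :: "('a::finite \<times> 'c::finite) vec" and f :: "'a vec \<Rightarrow> ('b::finite \<times> 'd::finite) vec"
  assumes F: "trilin F"
  shows "sw3 (reassoc (tmap f id t)) F = sw t (\<lambda>p z. sw (f p) (\<lambda>x y. F x y z))"
proof -
  have "bilin (\<lambda>u z. sw u (\<lambda>x y. F x y z))"
    using F by (intro bilinI lin_fun_sw_tensor lin_fun_sw_arg) (simp add: trilin_def)
  then show ?thesis by (simp add: sw3_reassoc[OF F] sw_tmap)
qed

lemma sw3_coassoc_right:
  fixes t :: "('a::finite \<times> 'c::finite) vec" and f :: "'c vec \<Rightarrow> ('b::finite \<times> 'd::finite) vec"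
  assumes F: "trilin F"
  shows "sw3 (tmap id f t) F = sw t (\<lambda>x p. sw (f p) (\<lambda>y z. F x y z))"
  by (simp add: sw3_def sw_tmap[OF bilin_sw3[OF F]])

lemma lin_mapI:
  assumes "\<And>\<phi>. lin_fun \<phi> \<Longrightarrow> lin_fun (\<lambda>x. \<phi> (f x))"
  shows "lin_map f"
proof -
  have "lin_fun (\<lambda>x. f x i)" for i
    by (rule assms[OF lin_fun_coord])
  then show ?thesis
    by (simp add: lin_map_def lin_fun_def fun_eq_iff vadd_def smul_def)
qed

section \<open>Pairings of tensor squares\<close>

lemma ptens_sw:
  fixes t :: "('i::finite \<times> 'i) vec" and s :: "('j::finite \<times> 'j) vec"
  shows "ptens p t s = sw t (\<lambda>x y. sw s (\<lambda>u v. p x u * p y v))"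
proof -
  have "ptens p t s = (\<Sum>x\<in>UNIV \<times> UNIV. t (fst x) * s (snd x) *
      p (bas (fst (fst x))) (bas (fst (snd x))) * p (bas (snd (fst x))) (bas (snd (snd x))))"
    by (simp add: ptens_def case_prod_unfold)
  also have "\<dots> = sw t (\<lambda>x y. sw s (\<lambda>u v. p x u * p y v))"
    by (simp add: sw_def case_prod_unfold sum_distrib_left mult_ac sum.cartesian_product del: UNIV_Times_UNIV)
  finally show ?thesis .
qed

lemma ptens_tens_right:
  fixes t :: "('i::finite \<times> 'i) vec" and b c :: "('j::finite) vec"
  assumes "bilin p"
  shows "ptens p t (tens b c) = sw t (\<lambda>x y. p x b * p y c)"
  by (simp add: ptens_sw sw_tens lin bilin_comp[OF assms])

lemma ptens_tens_left:
  fixes s :: "('j::finite \<times> 'j) vec" and b c :: "('i::finite) vec"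
  assumes "bilin p"
  shows "ptens p (tens b c) s = sw s (\<lambda>x y. p b x * p c y)"
  by (simp add: ptens_sw sw_tens lin bilin_comp[OF assms])

lemma lin_fun_eqD:
  assumes "lin_fun f" "f x = f y"
  shows "f (vadd x (smul (-1) y)) = 0"
  using assms by (simp add: lin_fun_def)

lemma vadd_minus_eq_zero: "vadd x (smul (-1) y) = vzero \<Longrightarrow> x = y"
  by (auto simp: vadd_def smul_def vzero_def fun_eq_iff)

text \<open>Nondegeneracy passes to tensor squares one leg at a time: the rows of a tensor are
  paired with \<open>c\<close> and the resulting vector with \<open>b\<close>, so \<open>nd\<close>
  first removes \<open>b\<close> and then \<open>c\<close>.\<close>

lemma ptens_nondegenerate:
  fixes t u :: "('i::finite \<times> 'i) vec" and q :: "'i vec \<Rightarrow> ('j::finite) vec \<Rightarrow> complex"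
  assumes q: "bilin q" and nd: "\<And>x y. (\<And>b. q x b = q y b) \<Longrightarrow> x = y"
    and eq: "\<And>b c. ptens q t (tens b c) = ptens q u (tens b c)"
  shows "t = u"
proof -
  have expand: "sw s (\<lambda>x y. q x b * q y c) = q (\<lambda>i. q (\<lambda>j. s (i, j)) c) b" for s :: "('i \<times> 'i) vec" and b c
  proof -
    have 1: "lin_fun (\<lambda>x. q x b)" for b using q by (simp add: bilin_def)
    have "q (\<lambda>i. q (\<lambda>j. s (i, j)) c) b = (\<Sum>i\<in>UNIV. q (\<lambda>j. s (i, j)) c * q (bas i) b)"
      by (rule lin_fun_expand[OF 1])
    also have "\<dots> = (\<Sum>i\<in>UNIV. (\<Sum>j\<in>UNIV. s (i, j) * q (bas j) c) * q (bas i) b)"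
      by (simp only: lin_fun_expand[OF 1, of "\<lambda>j. s (_, j)" c])
    also have "\<dots> = sw s (\<lambda>x y. q x b * q y c)"
      unfolding sw_def sum_distrib_right sum.cartesian_product UNIV_Times_UNIV by (simp add: mult_ac)
    finally show ?thesis by simp
  qed
  have "(\<lambda>i. q (\<lambda>j. t (i, j)) c) = (\<lambda>i. q (\<lambda>j. u (i, j)) c)" for c
    using eq by (intro nd) (simp add: ptens_tens_right[OF q] expand)
  then have "q (\<lambda>j. t (i, j)) c = q (\<lambda>j. u (i, j)) c" for i c
    by (rule fun_cong)
  then have "(\<lambda>j. t (i, j)) = (\<lambda>j. u (i, j))" for i
    by (intro nd) simp
  then show ?thesis by (auto simp: fun_eq_iff)
qed

section \<open>Sweedler calculus in a finite quantum groupoid\<close>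

locale qg =
  fixes G :: "('i::finite) qgroupoid"
  assumes qg: "fin_cqg G"
begin

abbreviation mul (infixl "\<cdot>" 70) where "x \<cdot> y \<equiv> qmul G x y"
abbreviation one ("\<one>") where "\<one> \<equiv> qunit G"
abbreviation star where "star \<equiv> qstar G"
abbreviation Del ("\<Delta>") where "\<Delta> \<equiv> qcomul G"
abbreviation eps ("\<epsilon>") where "\<epsilon> \<equiv> qcounit G"
abbreviation S where "S \<equiv> qanti G"
abbreviation At where "At \<equiv> range (eps_t G)"
abbreviation As where "As \<equiv> range (eps_s G)"

lemma cstar: "cstar_alg (qmul G) \<one> star"
  using qg by (simp add: fin_cqg_def Let_def)

lemma lin_mul_right: "lin_map (\<lambda>y. x \<cdot> y)"
  and lin_mul_left: "lin_map (\<lambda>x. x \<cdot> y)"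
  using cstar by (simp_all add: cstar_alg_def)

lemma assoc [simp]: "x \<cdot> y \<cdot> z = x \<cdot> (y \<cdot> z)"
  and one_left [simp]: "\<one> \<cdot> x = x"
  and one_right [simp]: "x \<cdot> \<one> = x"
  and star_star [simp]: "star (star x) = x"
  and star_mul: "star (x \<cdot> y) = star y \<cdot> star x"
  and star_add: "star (vadd x y) = vadd (star x) (star y)"
  and star_smul: "star (smul c x) = smul (cnj c) (star x)"
  using cstar unfolding cstar_alg_def by blast+

lemma star_one [simp]: "star \<one> = \<one>"
  by (metis one_left one_right star_mul star_star)

lemma lin_Del: "lin_map \<Delta>"
  and lin_eps: "lin_fun \<epsilon>"
  and lin_S: "lin_map S"
  and S_mul: "S (a \<cdot> b) = S b \<cdot> S a"
  and eps_S: "\<epsilon> (S a) = \<epsilon> a"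
  using qg by (simp_all add: fin_cqg_def Let_def)

lemmas lin_structure [lin] =
  lin_map_comp[OF lin_mul_left] lin_map_comp[OF lin_mul_right] lin_map_comp[OF lin_S]
  lin_map_comp[OF lin_Del] lin_fun_comp[OF lin_eps]

text \<open>The involution is antilinear, so conjugation restores linearity. Identities are mirrored
  through the involution by testing them with such functionals.\<close>

lemma lin_fun_cnj_star: "lin_fun \<phi> \<Longrightarrow> lin_fun (\<lambda>x. cnj (\<phi> (star x)))"
  by (simp add: lin_fun_def star_add star_smul)

lemma bilin_cnj_star: "bilin F \<Longrightarrow> bilin (\<lambda>x y. cnj (F (star x) (star y)))"
  by (simp add: bilin_def lin_fun_def star_add star_smul)

section \<open>Coproduct axioms in Sweedler form\<close>

lemma Del_mul:
  assumes F: "bilin F"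
  shows "sw (\<Delta> (a \<cdot> b)) F = sw (\<Delta> a) (\<lambda>x y. sw (\<Delta> b) (\<lambda>x' y'. F (x \<cdot> x') (y \<cdot> y')))"
proof -
  have "\<Delta> (a \<cdot> b) = tmult (qmul G) (qmul G) (\<Delta> a) (\<Delta> b)"
    using qg by (simp add: fin_cqg_def Let_def)
  then show ?thesis by (simp add: sw_tmult[OF F])
qed

lemma Del_one_left:
  assumes F: "bilin F"
  shows "sw (\<Delta> \<one>) (\<lambda>x y. sw (\<Delta> b) (\<lambda>x' y'. F (x \<cdot> x') (y \<cdot> y'))) = sw (\<Delta> b) F"
  using Del_mul[OF F, of \<one> b] by simp

lemma Del_one_right:
  assumes F: "bilin F"
  shows "sw (\<Delta> b) (\<lambda>x y. sw (\<Delta> \<one>) (\<lambda>x' y'. F (x \<cdot> x') (y \<cdot> y'))) = sw (\<Delta> b) F"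
  using Del_mul[OF F, of b \<one>] by simp

lemma Del_star:
  assumes F: "bilin F"
  shows "sw (\<Delta> (star a)) F = cnj (sw (\<Delta> a) (\<lambda>x y. cnj (F (star x) (star y))))"
proof -
  have "\<Delta> (star a) = tstar star star (\<Delta> a)"
    using qg by (simp add: fin_cqg_def Let_def)
  then show ?thesis by (simp add: sw_tstar[OF F])
qed

lemma Del_one_star:
  assumes F: "bilin F"
  shows "sw (\<Delta> \<one>) F = cnj (sw (\<Delta> \<one>) (\<lambda>x y. cnj (F (star x) (star y))))"
  using Del_star[OF F, of \<one>] by simp

lemma coassoc:
  assumes F: "trilin F"
  shows "sw (\<Delta> a) (\<lambda>x y. sw (\<Delta> x) (\<lambda>p q. F p q y)) = sw (\<Delta> a) (\<lambda>x y. sw (\<Delta> y) (\<lambda>q r. F x q r))"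
proof -
  have "reassoc (tmap \<Delta> id (\<Delta> a)) = tmap id \<Delta> (\<Delta> a)"
    using qg by (simp add: fin_cqg_def Let_def)
  then have "sw3 (reassoc (tmap \<Delta> id (\<Delta> a))) F = sw3 (tmap id \<Delta> (\<Delta> a)) F" by simp
  then show ?thesis by (simp add: sw3_coassoc_left[OF F] sw3_coassoc_right[OF F])
qed

text \<open>The Sweedler form of (1 \<otimes> t)(t \<otimes> 1). It is stated for arbitrary
  \<open>t\<close> since both \<Delta>(1) and the deformed coproduct of 1 are substituted for
  it.\<close>

lemma sw3_unit_product:
  assumes F: "trilin F"
  shows "sw3 (tmult (qmul G) (tmult (qmul G) (qmul G)) (tens \<one> t) (reassoc (tens t \<one>))) F
     = sw t (\<lambda>c d. sw t (\<lambda>a b. F c (a \<cdot> d) b))"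
proof -
  note F' = trilin_comp[OF F]
  have 1: "sw (tmult (qmul G) (qmul G) s d) (F c) = sw d (\<lambda>r z. sw s (\<lambda>p q. F c (p \<cdot> r) (q \<cdot> z)))" for s d c
    by (subst sw_tmult) (simp_all add: lin F' sw_swap[of s])
  have 2: "trilin (\<lambda>c r z. sw s (\<lambda>p q. F c (p \<cdot> r) (q \<cdot> z)))" for s
    by (simp add: lin F')
  have "sw3 (tmult (qmul G) (tmult (qmul G) (qmul G)) (tens \<one> t) (reassoc (tens t \<one>))) F
     = sw (tens \<one> t) (\<lambda>a s. sw3 (reassoc (tens t \<one>)) (\<lambda>c r z. sw s (\<lambda>p q. F (a \<cdot> c) (p \<cdot> r) (q \<cdot> z))))"
    unfolding sw3_def by (subst sw_tmult[OF bilin_sw3[OF F]]) (simp add: 1)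
  also have "\<dots> = sw3 (reassoc (tens t \<one>)) (\<lambda>c r z. sw t (\<lambda>p q. F c (p \<cdot> r) (q \<cdot> z)))"
    by (subst sw_tens) (simp_all add: lin F' sw3_def)
  also have "\<dots> = sw t (\<lambda>c d. sw t (\<lambda>a b. F c (a \<cdot> d) b))"
    by (simp add: sw3_reassoc[OF 2]) (subst sw_tens, simp_all add: lin F')
  finally show ?thesis .
qed

lemma Del_Del_one:
  assumes F: "trilin F"
  shows "sw (\<Delta> \<one>) (\<lambda>x y. sw (\<Delta> x) (\<lambda>p q. F p q y)) = sw (\<Delta> \<one>) (\<lambda>c d. sw (\<Delta> \<one>) (\<lambda>a b. F c (a \<cdot> d) b))"
proof -
  have "reassoc (tmap \<Delta> id (\<Delta> \<one>))
      = tmult (qmul G) (tmult (qmul G) (qmul G)) (tens \<one> (\<Delta> \<one>)) (reassoc (tens (\<Delta> \<one>) \<one>))"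
    using qg unfolding fin_cqg_def Let_def by blast
  from arg_cong[OF this, of "\<lambda>t. sw3 t F"] show ?thesis
    by (simp only: sw3_coassoc_left[OF F] sw3_unit_product[OF F])
qed

text \<open>The involution reverses the product in the middle leg of the unit axiom, so the factors
  1 \<otimes> \<Delta>(1) and \<Delta>(1) \<otimes> 1 may be taken in either order.\<close>

lemma Del_Del_one':
  assumes F: "trilin F"
  shows "sw (\<Delta> \<one>) (\<lambda>x y. sw (\<Delta> x) (\<lambda>p q. F p q y)) = sw (\<Delta> \<one>) (\<lambda>c d. sw (\<Delta> \<one>) (\<lambda>a b. F c (d \<cdot> a) b))"
proof -
  note F' = trilin_comp[OF F]
  define F2 where "F2 = (\<lambda>x y z. cnj (F (star x) (star y) (star z)))"
  have F2: "trilin F2"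
    using F by (simp add: F2_def trilin_def lin_fun_def star_add star_smul)
  have "sw (\<Delta> \<one>) (\<lambda>x y. sw (\<Delta> x) (\<lambda>p q. F p q y)) = cnj (sw (\<Delta> \<one>) (\<lambda>x y. sw (\<Delta> x) (\<lambda>p q. F2 p q y)))"
    by (subst Del_one_star) (simp_all add: lin F' Del_star F2_def)
  also have "\<dots> = cnj (sw (\<Delta> \<one>) (\<lambda>c d. sw (\<Delta> \<one>) (\<lambda>a b. F2 c (a \<cdot> d) b)))"
    by (simp add: Del_Del_one[OF F2])
  also have "\<dots> = sw (\<Delta> \<one>) (\<lambda>c d. sw (\<Delta> \<one>) (\<lambda>a b. F c (d \<cdot> a) b))"
  proof -
    have *: "sw (\<Delta> \<one>) (\<lambda>a b. F2 c (a \<cdot> d) b) = cnj (sw (\<Delta> \<one>) (\<lambda>a b. F (star c) (star d \<cdot> a) b))" for c d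
      by (subst (2) Del_one_star) (simp_all add: lin F' F2_def star_mul)
    show ?thesis unfolding * by (subst (3) Del_one_star) (simp_all add: lin F')
  qed
  finally show ?thesis .
qed

section \<open>Counit axioms in Sweedler form\<close>

lemma counit_left: "lin_fun \<phi> \<Longrightarrow> sw (\<Delta> a) (\<lambda>x y. \<epsilon> x * \<phi> y) = \<phi> a"
proof -
  assume \<phi>: "lin_fun \<phi>"
  have "slice_l \<epsilon> (\<Delta> a) = a" using qg by (simp add: fin_cqg_def Let_def)
  with lin_fun_slice_l[OF \<phi>, of \<epsilon> "\<Delta> a"] show ?thesis by simp
qed

lemma counit_right: "lin_fun \<phi> \<Longrightarrow> sw (\<Delta> a) (\<lambda>x y. \<phi> x * \<epsilon> y) = \<phi> a"
proof -
  assume \<phi>: "lin_fun \<phi>"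
  have "slice_r \<epsilon> (\<Delta> a) = a" using qg by (simp add: fin_cqg_def Let_def)
  with lin_fun_slice_r[OF \<phi>, of \<epsilon> "\<Delta> a"] show ?thesis by simp
qed

lemma eps_mul: "\<epsilon> (f \<cdot> (g \<cdot> h)) = sw (\<Delta> g) (\<lambda>x y. \<epsilon> (f \<cdot> x) * \<epsilon> (y \<cdot> h))"
  using qg by (simp add: fin_cqg_def Let_def tfun_sw)

text \<open>Both sides define counits, and counits are unique.\<close>
lemma eps_star: "\<epsilon> (star a) = cnj (\<epsilon> a)"
proof -
  define e where "e = (\<lambda>a. cnj (\<epsilon> (star a)))"
  have e: "lin_fun e" unfolding e_def by (rule lin_fun_cnj_star[OF lin_eps])
  have "e a = sw (\<Delta> a) (\<lambda>x y. e x * \<epsilon> y)" by (simp add: counit_right[OF e])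
  also have "\<dots> = sw (\<Delta> (star (star a))) (\<lambda>x y. e x * \<epsilon> y)" by simp
  also have "\<dots> = cnj (sw (\<Delta> (star a)) (\<lambda>x y. \<epsilon> x * e y))"
    by (subst Del_star) (simp_all add: lin e[unfolded e_def] lin_eps e_def)
  also have "\<dots> = \<epsilon> a" by (simp add: counit_left[OF e]) (simp add: e_def)
  finally show ?thesis unfolding e_def by (metis complex_cnj_cnj)
qed

text \<open>Taking adjoints in \<open>eps_mul\<close> reverses the products inside the counit, which
  exchanges the two legs of \<Delta>(g).\<close>

lemma eps_mul': "\<epsilon> (f \<cdot> (g \<cdot> h)) = sw (\<Delta> g) (\<lambda>x y. \<epsilon> (f \<cdot> y) * \<epsilon> (x \<cdot> h))"
proof -
  have "\<epsilon> (f \<cdot> (g \<cdot> h)) = cnj (\<epsilon> (star h \<cdot> (star g \<cdot> star f)))"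
    by (simp add: eps_star[symmetric] star_mul)
  also have "\<dots> = sw (\<Delta> g) (\<lambda>x y. \<epsilon> (x \<cdot> h) * \<epsilon> (f \<cdot> y))"
    by (subst eps_mul, subst Del_star) (simp_all add: lin eps_star[symmetric] star_mul)
  finally show ?thesis by (simp add: mult.commute)
qed

lemma eps_mul_one: "sw (\<Delta> \<one>) (\<lambda>x y. \<epsilon> (f \<cdot> y) * \<epsilon> (x \<cdot> h)) = \<epsilon> (f \<cdot> h)"
  using eps_mul'[of f \<one> h] by simp

section \<open>Antipode and counital maps\<close>

lemma Del_S:
  assumes F: "bilin F"
  shows "sw (\<Delta> (S a)) F = sw (\<Delta> a) (\<lambda>x y. F (S y) (S x))"
proof -
  have "\<Delta> (S a) = flip (tmap S S (\<Delta> a))"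
    using qg by (simp add: fin_cqg_def Let_def)
  moreover have "bilin (\<lambda>x y. F y x)" using F by (simp add: bilin_def)
  ultimately show ?thesis by (simp add: sw_flip sw_tmap)
qed

lemma fun_eps_t:
  assumes "lin_fun \<phi>"
  shows "\<phi> (eps_t G g) = sw (\<Delta> \<one>) (\<lambda>x y. \<epsilon> (x \<cdot> g) * \<phi> y)"
  unfolding eps_t_def lin_fun_slice_l[OF assms]
  by (subst sw_tmult, simp add: lin lin_eps assms)
     (subst sw_tens, simp_all add: lin lin_fun_comp[OF assms])

lemma fun_eps_s:
  assumes "lin_fun \<phi>"
  shows "\<phi> (eps_s G g) = sw (\<Delta> \<one>) (\<lambda>x y. \<phi> x * \<epsilon> (g \<cdot> y))"
  unfolding eps_s_def lin_fun_slice_r[OF assms]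
  by (subst sw_tmult, simp add: lin lin_eps assms)
     (subst sw_tens, simp_all add: lin lin_fun_comp[OF assms])

lemma fun_eps_t_S:
  assumes "lin_fun \<phi>"
  shows "\<phi> (eps_t G g) = sw (\<Delta> g) (\<lambda>x y. \<phi> (x \<cdot> S y))"
proof -
  have "eps_t G g = tm (qmul G) (tmap id S (\<Delta> g))"
    using qg by (simp add: fin_cqg_def Let_def)
  then show ?thesis
    by (simp add: lin_fun_tm[OF assms]) (subst sw_tmap, simp_all add: lin lin_fun_comp[OF assms])
qed

lemma eps_t_one: "eps_t G \<one> = \<one>"
  by (rule vec_eqI) (simp add: fun_eps_t counit_left)

text \<open>Since S(y)S(1) = S(1 y) = S(y), right multiplication by S(1) fixes
  \<open>1_1 S(1_2)\<close>, which is 1 by the antipode axiom.\<close>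

lemma S_one [simp]: "S \<one> = \<one>"
proof (rule vec_eqI)
  fix \<phi> :: "'i vec \<Rightarrow> complex" assume \<phi>: "lin_fun \<phi>"
  have *: "S y \<cdot> S \<one> = S y" for y by (simp add: S_mul[symmetric])
  have "\<phi> (S \<one>) = \<phi> (eps_t G \<one> \<cdot> S \<one>)" by (simp add: eps_t_one)
  also have "\<dots> = \<phi> (eps_t G \<one>)"
    using fun_eps_t_S[of "\<lambda>x. \<phi> (x \<cdot> S \<one>)" \<one>] fun_eps_t_S[OF \<phi>, of \<one>] \<phi>
    by (simp add: lin_fun_comp[OF \<phi>] lin *)
  finally show "\<phi> (S \<one>) = \<phi> \<one>" by (simp add: eps_t_one)
qed

lemma Del_one_S:
  assumes F: "bilin F"
  shows "sw (\<Delta> \<one>) (\<lambda>x y. F (S y) (S x)) = sw (\<Delta> \<one>) F"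
  using Del_S[OF F, of \<one>] by simp

lemma lin_eps_t: "lin_map (eps_t G)"
  by (rule lin_mapI) (simp add: fun_eps_t lin)

lemma lin_eps_s: "lin_map (eps_s G)"
  by (rule lin_mapI) (simp add: fun_eps_s lin)

lemmas lin_counital [lin] = lin_map_comp[OF lin_eps_t] lin_map_comp[OF lin_eps_s]

subsection \<open>Counital subalgebras\<close>

text \<open>Write z as \<open>\<epsilon>(1_1 g) 1_2\<close>. Coassociativity moves the coproduct of
  the second leg to the first, and the two orders of the factors in the unit axiom then put z on the
  right or on the left.\<close>

lemma Del_At:
  assumes z: "z \<in> At" and F: "bilin F"
  shows "sw (\<Delta> z) F = sw (\<Delta> \<one>) (\<lambda>x y. F (x \<cdot> z) y)"
    and "sw (\<Delta> z) F = sw (\<Delta> \<one>) (\<lambda>x y. F (z \<cdot> x) y)"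
proof -
  note F' = bilin_comp[OF F]
  obtain g where g: "z = eps_t G g" using z by auto
  have tri: "trilin (\<lambda>p q r. \<epsilon> (p \<cdot> g) * F q r)" by (simp add: lin F')
  have "sw (\<Delta> z) F = sw (\<Delta> \<one>) (\<lambda>x y. sw (\<Delta> y) (\<lambda>q r. \<epsilon> (x \<cdot> g) * F q r))"
    unfolding g by (subst fun_eps_t[of "\<lambda>z. sw (\<Delta> z) F"]) (simp_all add: lin sw_times)
  then have *: "sw (\<Delta> z) F = sw (\<Delta> \<one>) (\<lambda>x y. sw (\<Delta> x) (\<lambda>p q. \<epsilon> (p \<cdot> g) * F q y))"
    by (simp add: coassoc[OF tri])
  show "sw (\<Delta> z) F = sw (\<Delta> \<one>) (\<lambda>x y. F (x \<cdot> z) y)"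
    unfolding * Del_Del_one[OF tri]
    by (subst sw_swap, intro arg_cong[of _ _ "sw _"] ext)
       (simp add: g fun_eps_t[of "\<lambda>z. F (_ \<cdot> z) _"] lin F')
  show "sw (\<Delta> z) F = sw (\<Delta> \<one>) (\<lambda>x y. F (z \<cdot> x) y)"
    unfolding * Del_Del_one'[OF tri]
    by (subst sw_swap, intro arg_cong[of _ _ "sw _"] ext)
       (simp add: g fun_eps_t[of "\<lambda>z. F (z \<cdot> _) _"] lin F')
qed

lemma Del_As:
  assumes y: "y \<in> As" and F: "bilin F"
  shows "sw (\<Delta> y) F = sw (\<Delta> \<one>) (\<lambda>a b. F a (y \<cdot> b))"
    and "sw (\<Delta> y) F = sw (\<Delta> \<one>) (\<lambda>a b. F a (b \<cdot> y))"
proof -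
  note F' = bilin_comp[OF F]
  obtain g where g: "y = eps_s G g" using y by auto
  have tri: "trilin (\<lambda>p q r. F p q * \<epsilon> (g \<cdot> r))" by (simp add: lin F')
  have *: "sw (\<Delta> y) F = sw (\<Delta> \<one>) (\<lambda>x b. sw (\<Delta> x) (\<lambda>p q. F p q * \<epsilon> (g \<cdot> b)))"
    unfolding g by (subst fun_eps_s[of "\<lambda>z. sw (\<Delta> z) F"]) (simp_all add: lin sw_times)
  show "sw (\<Delta> y) F = sw (\<Delta> \<one>) (\<lambda>a b. F a (y \<cdot> b))"
    unfolding * Del_Del_one[OF tri]
    by (simp add: g fun_eps_s[of "\<lambda>z. F _ (z \<cdot> _)"] lin F')
  show "sw (\<Delta> y) F = sw (\<Delta> \<one>) (\<lambda>a b. F a (b \<cdot> y))"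
    unfolding * Del_Del_one'[OF tri]
    by (simp add: g fun_eps_s[of "\<lambda>z. F _ (_ \<cdot> z)"] lin F')
qed

lemma Del_At_mul:
  assumes z: "z \<in> At" and F: "bilin F"
  shows "sw (\<Delta> (z \<cdot> a)) F = sw (\<Delta> a) (\<lambda>x y. F (z \<cdot> x) y)"
    and "sw (\<Delta> (a \<cdot> z)) F = sw (\<Delta> a) (\<lambda>x y. F (x \<cdot> z) y)"
proof -
  note F' = bilin_comp[OF F]
  show "sw (\<Delta> (z \<cdot> a)) F = sw (\<Delta> a) (\<lambda>x y. F (z \<cdot> x) y)"
    using Del_one_left[of "\<lambda>x y. F (z \<cdot> x) y" a]
    by (simp add: Del_mul F lin F' Del_At(2)[OF z])
  have "sw (\<Delta> a) (\<lambda>x y. sw (\<Delta> z) (\<lambda>x' y'. F (x \<cdot> x') (y \<cdot> y'))) = 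
     sw (\<Delta> a) (\<lambda>x y. sw (\<Delta> \<one>) (\<lambda>x' y'. F (x \<cdot> x' \<cdot> z) (y \<cdot> y')))"
    by (subst Del_At(1)[OF z]) (simp_all add: lin F')
  also have "\<dots> = sw (\<Delta> a) (\<lambda>x y. F (x \<cdot> z) y)"
    by (rule Del_one_right[of "\<lambda>x y. F (x \<cdot> z) y" a]) (simp add: lin F')
  finally show "sw (\<Delta> (a \<cdot> z)) F = sw (\<Delta> a) (\<lambda>x y. F (x \<cdot> z) y)"
    by (simp add: Del_mul F)
qed

lemma Del_As_mul:
  assumes z: "z \<in> As" and F: "bilin F"
  shows "sw (\<Delta> (z \<cdot> a)) F = sw (\<Delta> a) (\<lambda>x y. F x (z \<cdot> y))"
    and "sw (\<Delta> (a \<cdot> z)) F = sw (\<Delta> a) (\<lambda>x y. F x (y \<cdot> z))"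
proof -
  note F' = bilin_comp[OF F]
  show "sw (\<Delta> (z \<cdot> a)) F = sw (\<Delta> a) (\<lambda>x y. F x (z \<cdot> y))"
    using Del_one_left[of "\<lambda>x y. F x (z \<cdot> y)" a]
    by (simp add: Del_mul F lin F' Del_As(1)[OF z])
  have "sw (\<Delta> a) (\<lambda>x y. sw (\<Delta> z) (\<lambda>x' y'. F (x \<cdot> x') (y \<cdot> y'))) = 
     sw (\<Delta> a) (\<lambda>x y. sw (\<Delta> \<one>) (\<lambda>x' y'. F (x \<cdot> x') (y \<cdot> y' \<cdot> z)))"
    by (subst Del_As(2)[OF z]) (simp_all add: lin F')
  also have "\<dots> = sw (\<Delta> a) (\<lambda>x y. F x (y \<cdot> z))"
    by (rule Del_one_right[of "\<lambda>x y. F x (y \<cdot> z)" a]) (simp add: lin F')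
  finally show "sw (\<Delta> (a \<cdot> z)) F = sw (\<Delta> a) (\<lambda>x y. F x (y \<cdot> z))"
    by (simp add: Del_mul F)
qed

text \<open>The counit is applied to the first leg in \<open>Del_At\<close>. The first formula makes
  \<open>eps_t\<close> a projection onto \<open>At\<close>; the second is its adjoint form.\<close>

lemma At_expand:
  assumes z: "z \<in> At" and \<phi>: "lin_fun \<phi>"
  shows "sw (\<Delta> \<one>) (\<lambda>x y. \<epsilon> (x \<cdot> z) * \<phi> y) = \<phi> z"
    and "sw (\<Delta> \<one>) (\<lambda>x y. \<epsilon> (z \<cdot> x) * \<phi> y) = \<phi> z"
proof -
  have F: "bilin (\<lambda>x y. \<epsilon> x * \<phi> y)" by (simp add: lin lin_eps \<phi>)
  show "sw (\<Delta> \<one>) (\<lambda>x y. \<epsilon> (x \<cdot> z) * \<phi> y) = \<phi> z"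
    "sw (\<Delta> \<one>) (\<lambda>x y. \<epsilon> (z \<cdot> x) * \<phi> y) = \<phi> z"
    using Del_At[OF z F] by (simp_all add: counit_left[OF \<phi>])
qed

lemma As_expand:
  assumes y: "y \<in> As" and \<phi>: "lin_fun \<phi>"
  shows "sw (\<Delta> \<one>) (\<lambda>a b. \<phi> a * \<epsilon> (y \<cdot> b)) = \<phi> y"
    and "sw (\<Delta> \<one>) (\<lambda>a b. \<phi> a * \<epsilon> (b \<cdot> y)) = \<phi> y"
proof -
  have F: "bilin (\<lambda>x y. \<phi> x * \<epsilon> y)" by (simp add: lin lin_eps \<phi>)
  show "sw (\<Delta> \<one>) (\<lambda>a b. \<phi> a * \<epsilon> (y \<cdot> b)) = \<phi> y"
    "sw (\<Delta> \<one>) (\<lambda>a b. \<phi> a * \<epsilon> (b \<cdot> y)) = \<phi> y"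
    using Del_As[OF y F] by (simp_all add: counit_right[OF \<phi>])
qed

lemma eps_t_At: "z \<in> At \<Longrightarrow> eps_t G z = z"
  by (rule vec_eqI) (simp add: fun_eps_t At_expand)

lemma eps_s_As: "y \<in> As \<Longrightarrow> eps_s G y = y"
  by (rule vec_eqI) (simp add: fun_eps_s As_expand)

lemma At_I: "eps_t G z = z \<Longrightarrow> z \<in> At"
  by (metis rangeI)

lemma As_I: "eps_s G z = z \<Longrightarrow> z \<in> As"
  by (metis rangeI)

lemma star_At: assumes z: "z \<in> At" shows "star z \<in> At"
proof (rule At_I, rule vec_eqI)
  fix \<phi> :: "'i vec \<Rightarrow> complex" assume \<phi>: "lin_fun \<phi>"
  have "\<phi> (eps_t G (star z)) = cnj (sw (\<Delta> \<one>) (\<lambda>x y. \<epsilon> (z \<cdot> x) * cnj (\<phi> (star y))))"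
    by (simp add: fun_eps_t[OF \<phi>], subst Del_one_star)
       (simp_all add: lin \<phi> eps_star[symmetric] star_mul)
  then show "\<phi> (eps_t G (star z)) = \<phi> (star z)"
    by (simp add: At_expand(2)[OF z lin_fun_cnj_star[OF \<phi>]])
qed

lemma star_As: assumes z: "z \<in> As" shows "star z \<in> As"
proof (rule As_I, rule vec_eqI)
  fix \<phi> :: "'i vec \<Rightarrow> complex" assume \<phi>: "lin_fun \<phi>"
  have "\<phi> (eps_s G (star z)) = cnj (sw (\<Delta> \<one>) (\<lambda>x y. cnj (\<phi> (star x)) * \<epsilon> (y \<cdot> z)))"
    by (simp add: fun_eps_s[OF \<phi>], subst Del_one_star)
       (simp_all add: lin \<phi> eps_star[symmetric] star_mul)
  then show "\<phi> (eps_s G (star z)) = \<phi> (star z)"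
    by (simp add: As_expand(2)[OF z lin_fun_cnj_star[OF \<phi>]])
qed

lemma At_mul: assumes "z \<in> At" "z' \<in> At" shows "z \<cdot> z' \<in> At"
proof (rule At_I, rule vec_eqI)
  fix \<phi> :: "'i vec \<Rightarrow> complex" assume \<phi>: "lin_fun \<phi>"
  have F: "bilin (\<lambda>x y. \<epsilon> x * \<phi> y)" by (simp add: lin lin_eps \<phi>)
  have "\<phi> (z \<cdot> z') = sw (\<Delta> (z \<cdot> z')) (\<lambda>x y. \<epsilon> x * \<phi> y)" by (simp add: counit_left[OF \<phi>])
  also have "\<dots> = sw (\<Delta> z) (\<lambda>x y. \<epsilon> (x \<cdot> z') * \<phi> y)"
    by (simp add: Del_At_mul(2)[OF assms(2) F])
  also have "\<dots> = sw (\<Delta> \<one>) (\<lambda>x y. \<epsilon> (x \<cdot> z \<cdot> z') * \<phi> y)"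
    by (subst Del_At(1)[OF assms(1)]) (simp_all add: lin \<phi>)
  finally show "\<phi> (eps_t G (z \<cdot> z')) = \<phi> (z \<cdot> z')" by (simp add: fun_eps_t[OF \<phi>])
qed

text \<open>From w z = 1 follows \<Delta>(1) = \<Delta>(w)(z \<otimes> 1), so \<open>eps_t\<close>
  of w is \<open>\<epsilon>(w_1 z w) w_2\<close>, and z w = 1 reduces this to w.\<close>

lemma At_inverse:
  assumes z: "z \<in> At" and inv: "w \<cdot> z = \<one>" "z \<cdot> w = \<one>"
  shows "w \<in> At"
proof (rule At_I, rule vec_eqI)
  fix \<phi> :: "'i vec \<Rightarrow> complex" assume \<phi>: "lin_fun \<phi>"
  have "\<phi> (eps_t G w) = sw (\<Delta> (w \<cdot> z)) (\<lambda>x y. \<epsilon> (x \<cdot> w) * \<phi> y)"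
    by (simp add: fun_eps_t[OF \<phi>] inv)
  also have "\<dots> = sw (\<Delta> w) (\<lambda>x y. \<epsilon> x * \<phi> y)"
    by (subst Del_At_mul(2)[OF z]) (simp_all add: lin \<phi> inv)
  finally show "\<phi> (eps_t G w) = \<phi> w" by (simp add: counit_left[OF \<phi>])
qed

text \<open>Elements of \<open>At\<close> multiply only the first leg of a coproduct and elements of
  \<open>As\<close> only the second, so \<Delta>(yz) and \<Delta>(zy) both equal (z \<otimes>
  y)\<Delta>(1).\<close>

lemma At_As_commute:
  assumes z: "z \<in> At" and y: "y \<in> As"
  shows "y \<cdot> z = z \<cdot> y"
proof (rule vec_eqI)
  fix \<phi> :: "'i vec \<Rightarrow> complex" assume \<phi>: "lin_fun \<phi>"
  have F: "bilin (\<lambda>x y. \<epsilon> x * \<phi> y)" by (simp add: lin lin_eps \<phi>)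
  note l = lin lin_fun_comp[OF \<phi>]
  have "\<phi> (y \<cdot> z) = sw (\<Delta> (y \<cdot> z)) (\<lambda>x y. \<epsilon> x * \<phi> y)" by (simp add: counit_left[OF \<phi>])
  also have "\<dots> = sw (\<Delta> \<one>) (\<lambda>a b. \<epsilon> (z \<cdot> a) * \<phi> (y \<cdot> b))"
    by (subst Del_As_mul(1)[OF y F], subst Del_At(2)[OF z]) (simp_all add: l lin_eps)
  also have "\<dots> = sw (\<Delta> (z \<cdot> y)) (\<lambda>x y. \<epsilon> x * \<phi> y)"
    by (subst Del_At_mul(1)[OF z F], subst Del_As(1)[OF y]) (simp_all add: l lin_eps \<phi>)
  finally show "\<phi> (y \<cdot> z) = \<phi> (z \<cdot> y)" by (simp add: counit_left[OF \<phi>])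
qed

text \<open>Expand \<open>g 1_2\<close> as \<open>\<epsilon>(g_1 1_2) g_2 1_3\<close>. The unit
  axiom splits the triple coproduct of 1 into two copies of \<Delta>(1); one is absorbed by
  \<Delta>(g), and the other produces \<open>eps_s\<close>.\<close>

lemma Del_eps_s:
  assumes F: "bilin F"
  shows "sw (\<Delta> g) (\<lambda>a b. F (eps_s G a) b) = sw (\<Delta> \<one>) (\<lambda>a b. F a (g \<cdot> b))"
proof -
  note F' = bilin_comp[OF F]
  have "sw (\<Delta> \<one>) (\<lambda>c d. F c (g \<cdot> d)) 
     = sw (\<Delta> \<one>) (\<lambda>c d. sw (\<Delta> d) (\<lambda>p q. sw (\<Delta> g) (\<lambda>a b. \<epsilon> (a \<cdot> p) * F c (b \<cdot> q))))"
  proof -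
    have "F c (g \<cdot> d) = sw (\<Delta> d) (\<lambda>p q. sw (\<Delta> g) (\<lambda>a b. \<epsilon> (a \<cdot> p) * F c (b \<cdot> q)))" for c d
      using counit_left[of "F c" "g \<cdot> d"]
      by (simp add: lin F' Del_mul lin_eps sw_swap[of "\<Delta> g"])
    then show ?thesis by simp
  qed
  also have "\<dots> = sw (\<Delta> \<one>) (\<lambda>c d. sw (\<Delta> \<one>) (\<lambda>p q. sw (\<Delta> g) (\<lambda>a b. \<epsilon> (a \<cdot> (p \<cdot> d)) * F c (b \<cdot> q))))"
    by (subst coassoc[symmetric], simp add: lin F', subst Del_Del_one) (simp_all add: lin F')
  also have "\<dots> = sw (\<Delta> \<one>) (\<lambda>c d. sw (\<Delta> g) (\<lambda>a b. \<epsilon> (a \<cdot> d) * F c b))"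
  proof -
    have "sw (\<Delta> \<one>) (\<lambda>p q. sw (\<Delta> g) (\<lambda>a b. \<epsilon> (a \<cdot> (p \<cdot> d)) * F c (b \<cdot> q)))
        = sw (\<Delta> g) (\<lambda>a b. \<epsilon> (a \<cdot> d) * F c b)" for c d
      using Del_one_right[of "\<lambda>a b. \<epsilon> (a \<cdot> d) * F c b" g]
      by (simp add: lin F' sw_swap[of "\<Delta> \<one>"])
    then show ?thesis by simp
  qed
  also have "\<dots> = sw (\<Delta> g) (\<lambda>a b. sw (\<Delta> \<one>) (\<lambda>c d. F c b * \<epsilon> (a \<cdot> d)))"
    by (subst sw_swap) (simp add: mult.commute)
  also have "\<dots> = sw (\<Delta> g) (\<lambda>a b. F (eps_s G a) b)"
    by (subst fun_eps_s[of "\<lambda>c. F c _"]) (simp_all add: lin F')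
  finally show ?thesis by simp
qed

text \<open>The mirror image of \<open>Del_eps_s\<close>: the counit is inserted into the second leg
  of the coproduct of \<open>1_1 g\<close>.\<close>

lemma Del_eps_t:
  assumes F: "bilin F"
  shows "sw (\<Delta> g) (\<lambda>a b. F a (eps_t G b)) = sw (\<Delta> \<one>) (\<lambda>a b. F (a \<cdot> g) b)"
proof -
  note F' = bilin_comp[OF F]
  have "sw (\<Delta> \<one>) (\<lambda>c d. F (c \<cdot> g) d) 
     = sw (\<Delta> \<one>) (\<lambda>c d. sw (\<Delta> c) (\<lambda>p q. sw (\<Delta> g) (\<lambda>a b. F (p \<cdot> a) d * \<epsilon> (q \<cdot> b))))"
  proof -
    have "F (c \<cdot> g) d = sw (\<Delta> c) (\<lambda>p q. sw (\<Delta> g) (\<lambda>a b. F (p \<cdot> a) d * \<epsilon> (q \<cdot> b)))" for c d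
      using counit_right[of "\<lambda>x. F x d" "c \<cdot> g"]
      by (simp add: lin F' Del_mul lin_eps)
    then show ?thesis by simp
  qed
  also have "\<dots> = sw (\<Delta> \<one>) (\<lambda>p d. sw (\<Delta> \<one>) (\<lambda>x y. sw (\<Delta> g) (\<lambda>a b. F (p \<cdot> a) y * \<epsilon> (x \<cdot> (d \<cdot> b)))))"
    by (subst Del_Del_one) (simp_all add: lin F')
  also have "\<dots> = sw (\<Delta> \<one>) (\<lambda>x y. sw (\<Delta> g) (\<lambda>a b. F a y * \<epsilon> (x \<cdot> b)))"
  proof -
    have "sw (\<Delta> \<one>) (\<lambda>p d. sw (\<Delta> g) (\<lambda>a b. F (p \<cdot> a) y * \<epsilon> (x \<cdot> (d \<cdot> b))))
        = sw (\<Delta> g) (\<lambda>a b. F a y * \<epsilon> (x \<cdot> b))" for x y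
      using Del_one_left[of "\<lambda>a b. F a y * \<epsilon> (x \<cdot> b)" g]
      by (simp add: lin F')
    then show ?thesis by (subst sw_swap) simp
  qed
  also have "\<dots> = sw (\<Delta> g) (\<lambda>a b. sw (\<Delta> \<one>) (\<lambda>c d. \<epsilon> (c \<cdot> b) * F a d))"
    by (subst sw_swap) (simp add: mult.commute)
  also have "\<dots> = sw (\<Delta> g) (\<lambda>a b. F a (eps_t G b))"
    by (subst fun_eps_t[of "\<lambda>c. F _ c"]) (simp_all add: lin F')
  finally show ?thesis by simp
qed

text \<open>This expresses \<open>\<Delta>(1) \<in> A\<^sub>s \<otimes> A\<^sub>t\<close>.\<close>
lemma Del_one_cong:
  assumes F: "bilin F" and F2: "bilin F2"
    and eq: "\<And>a b. a \<in> As \<Longrightarrow> b \<in> At \<Longrightarrow> F a b = F2 a b"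
  shows "sw (\<Delta> \<one>) F = sw (\<Delta> \<one>) F2"
proof -
  have *: "sw (\<Delta> \<one>) (\<lambda>a b. F (eps_s G a) (eps_t G b)) = sw (\<Delta> \<one>) F" if "bilin F" for F
    using Del_eps_s[of "\<lambda>a b. F a (eps_t G b)" \<one>] Del_eps_t[OF that, of \<one>]
    by (simp add: lin bilin_comp[OF that])
  show ?thesis
    using *[OF F] *[OF F2] by (simp add: eq)
qed

section \<open>The antipode on the counital subalgebras\<close>

lemma S_As: assumes y: "y \<in> As" shows "eps_t G y = S y"
proof (rule vec_eqI)
  fix \<phi> :: "'i vec \<Rightarrow> complex" assume \<phi>: "lin_fun \<phi>"
  note l = lin lin_fun_comp[OF \<phi>]
  \<comment> \<open>The antipode axiom is applied to \<Delta>(y) = (1 \<otimes> y)\<Delta>(1), so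
    that S(y) splits off on the right of \<open>1_1 S(1_2)\<close>.\<close>
  have "\<phi> (eps_t G y) = sw (\<Delta> \<one>) (\<lambda>a b. \<phi> (a \<cdot> S b \<cdot> S y))"
    by (simp add: fun_eps_t_S[OF \<phi>], subst Del_As(1)[OF y]) (simp_all add: l S_mul)
  also have "\<dots> = \<phi> (eps_t G \<one> \<cdot> S y)"
    by (subst fun_eps_t_S[of "\<lambda>x. \<phi> (x \<cdot> S y)"]) (simp_all add: l)
  finally show "\<phi> (eps_t G y) = \<phi> (S y)" by (simp add: eps_t_one)
qed

lemma S_As_At: "y \<in> As \<Longrightarrow> S y \<in> At"
  by (metis S_As rangeI)

text \<open>Weak multiplicativity of the counit allows a factor a to be replaced by
  \<open>eps_t G a\<close>, and \<open>eps_t\<close> agrees with S on \<open>As\<close>.\<close>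

lemma eps_S_right: assumes "a \<in> As" shows "\<epsilon> (x \<cdot> S a) = \<epsilon> (x \<cdot> a)"
  using fun_eps_t[of "\<lambda>y. \<epsilon> (x \<cdot> y)" a] eps_mul_one[of x a]
  by (simp add: lin S_As[OF assms] mult.commute)

text \<open>The antipode axiom speaks of \<open>eps_t\<close>. The passage to \<open>eps_s\<close>
  uses that \<Delta>(1) is invariant under the flip combined with S \<otimes> S; the S that appears
  inside the counit is removed by \<open>eps_S_right\<close>.\<close>

lemma S_At: assumes z: "z \<in> At" shows "eps_s G z = S z"
proof (rule vec_eqI)
  fix \<phi> :: "'i vec \<Rightarrow> complex" assume \<phi>: "lin_fun \<phi>"
  note l = lin lin_fun_comp[OF \<phi>] \<phi>
  have "\<phi> (eps_s G z) = sw (\<Delta> \<one>) (\<lambda>a b. \<phi> (S b) * \<epsilon> (z \<cdot> S a))"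
    by (simp add: fun_eps_s[OF \<phi>], subst Del_one_S[symmetric]) (simp_all add: l)
  also have "\<dots> = sw (\<Delta> \<one>) (\<lambda>a b. \<epsilon> (z \<cdot> a) * \<phi> (S b))"
    by (rule Del_one_cong) (simp_all add: l eps_S_right)
  also have "\<dots> = \<phi> (S z)"
    by (rule At_expand(2)[OF z]) (simp add: l)
  finally show "\<phi> (eps_s G z) = \<phi> (S z)" .
qed

lemma S_At_As: "z \<in> At \<Longrightarrow> S z \<in> As"
  by (metis S_At rangeI)

lemma eps_S_left: assumes "z \<in> At" shows "\<epsilon> (S z \<cdot> x) = \<epsilon> (z \<cdot> x)"
  using fun_eps_s[of "\<lambda>y. \<epsilon> (y \<cdot> x)" z] eps_mul_one[of z x]
  by (simp add: lin S_At[OF assms] mult.commute)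

text \<open>S agrees with \<open>eps_t\<close> at \<open>star y\<close>, so after conjugation the
  left side becomes \<open>\<epsilon>(y 1_1) S(1_2)\<close>. The invariance of \<Delta>(1) under the
  flipped S \<otimes> S turns this into \<open>eps_s G y\<close>.\<close>

lemma S_star_S_star_As: assumes y: "y \<in> As" shows "S (star (S (star y))) = y"
proof (rule vec_eqI)
  fix \<phi> :: "'i vec \<Rightarrow> complex" assume \<phi>: "lin_fun \<phi>"
  note l = lin lin_fun_comp[OF \<phi>] \<phi>
  have \<phi>2: "lin_fun (\<lambda>x. \<phi> (S x))" by (simp add: l)
  have "\<phi> (S (star (S (star y)))) = cnj (cnj (\<phi> (S (star (eps_t G (star y))))))"
    by (simp add: S_As star_As y)
  also have "\<dots> = cnj (sw (\<Delta> \<one>) (\<lambda>a b. \<epsilon> (a \<cdot> star y) * cnj (\<phi> (S (star b)))))"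
    by (subst fun_eps_t[OF lin_fun_cnj_star[OF \<phi>2]]) simp
  also have "\<dots> = sw (\<Delta> \<one>) (\<lambda>a b. \<epsilon> (y \<cdot> a) * \<phi> (S b))"
    by (subst (2) Del_one_star) (simp_all add: l eps_star[symmetric] star_mul)
  also have "\<dots> = sw (\<Delta> \<one>) (\<lambda>a b. \<phi> (S b) * \<epsilon> (y \<cdot> S a))"
    by (rule Del_one_cong) (simp_all add: l eps_S_right)
  also have "\<dots> = \<phi> (eps_s G y)"
    by (subst Del_one_S[of "\<lambda>a b. \<phi> a * \<epsilon> (y \<cdot> b)"]) (simp_all add: l fun_eps_s)
  finally show "\<phi> (S (star (S (star y)))) = \<phi> y" by (simp add: eps_s_As[OF y])
qed

text \<open>The same argument with the two subalgebras exchanged; it ends at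
  \<open>eps_t G z\<close>.\<close>

lemma S_star_S_star_At: assumes z: "z \<in> At" shows "S (star (S (star z))) = z"
proof (rule vec_eqI)
  fix \<phi> :: "'i vec \<Rightarrow> complex" assume \<phi>: "lin_fun \<phi>"
  note l = lin lin_fun_comp[OF \<phi>] \<phi>
  have \<phi>2: "lin_fun (\<lambda>x. \<phi> (S x))" by (simp add: l)
  have "\<phi> (S (star (S (star z)))) = cnj (cnj (\<phi> (S (star (eps_s G (star z))))))"
    by (simp add: S_At star_At z)
  also have "\<dots> = cnj (sw (\<Delta> \<one>) (\<lambda>a b. cnj (\<phi> (S (star a))) * \<epsilon> (star z \<cdot> b)))"
    by (subst fun_eps_s[OF lin_fun_cnj_star[OF \<phi>2]]) simp
  also have "\<dots> = sw (\<Delta> \<one>) (\<lambda>a b. \<phi> (S a) * \<epsilon> (b \<cdot> z))"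
    by (subst (2) Del_one_star) (simp_all add: l eps_star[symmetric] star_mul)
  also have "\<dots> = sw (\<Delta> \<one>) (\<lambda>a b. \<epsilon> (S b \<cdot> z) * \<phi> (S a))"
    by (rule Del_one_cong) (simp_all add: l eps_S_left)
  also have "\<dots> = \<phi> (eps_t G z)"
    by (subst Del_one_S[of "\<lambda>a b. \<epsilon> (a \<cdot> z) * \<phi> b"]) (simp_all add: l fun_eps_t)
  finally show "\<phi> (S (star (S (star z)))) = \<phi> z" by (simp add: eps_t_At[OF z])
qed

lemma eps_t_At_mul: assumes z: "z \<in> At" shows "eps_t G (z \<cdot> g) = z \<cdot> eps_t G g"
proof (rule vec_eqI)
  fix \<phi> :: "'i vec \<Rightarrow> complex" assume \<phi>: "lin_fun \<phi>"
  note l = lin lin_fun_comp[OF \<phi>] \<phi>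
  show "\<phi> (eps_t G (z \<cdot> g)) = \<phi> (z \<cdot> eps_t G g)"
    using fun_eps_t_S[of "\<lambda>x. \<phi> (z \<cdot> x)" g]
    by (simp add: l fun_eps_t_S[OF \<phi>] Del_At_mul(1)[OF z])
qed

section \<open>Moving counital elements across the legs of a coproduct\<close>

lemma Del_one_As_right:
  assumes a: "a \<in> As" and F: "bilin F"
  shows "sw (\<Delta> \<one>) (\<lambda>x y. F (x \<cdot> a) y) = sw (\<Delta> \<one>) (\<lambda>x y. F x (y \<cdot> S a))"
proof -
  note F' = bilin_comp[OF F]
  \<comment> \<open>By \<open>Del_eps_t\<close> a factor a on the first leg is the same as
    \<open>eps_t\<close> on the second leg of \<Delta>(a) = \<Delta>(1)(1 \<otimes> a). As that leg
    of \<Delta>(1) lies in \<open>At\<close>, it can be pulled out of \<open>eps_t\<close>, which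
    leaves S(a).\<close>
  have "sw (\<Delta> \<one>) (\<lambda>x y. F (x \<cdot> a) y) = sw (\<Delta> a) (\<lambda>x y. F x (eps_t G y))"
    by (simp add: Del_eps_t[OF F])
  also have "\<dots> = sw (\<Delta> \<one>) (\<lambda>x y. F x (eps_t G (y \<cdot> a)))"
    by (subst Del_As(2)[OF a]) (simp_all add: lin F')
  also have "\<dots> = sw (\<Delta> \<one>) (\<lambda>x y. F x (y \<cdot> S a))"
    by (rule Del_one_cong) (simp_all add: lin F' eps_t_At_mul S_As[OF a])
  finally show ?thesis .
qed

text \<open>The adjoint of \<open>Del_one_As_right\<close> at \<open>star (S z)\<close>; the
  relation \<open>S_star_S_star_At\<close> says that S takes this element to
  \<open>star z\<close>.\<close>

lemma Del_one_At_left: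
  assumes z: "z \<in> At" and F: "bilin F"
  shows "sw (\<Delta> \<one>) (\<lambda>x y. F x (z \<cdot> y)) = sw (\<Delta> \<one>) (\<lambda>x y. F (S z \<cdot> x) y)"
proof -
  note F' = bilin_comp[OF F]
  have Sz: "star (S z) \<in> As" by (simp add: S_At_As star_As z)
  have SS: "S (star (S z)) = star z"
    using S_star_S_star_At[OF star_At[OF z]] by simp
  have "sw (\<Delta> \<one>) (\<lambda>x y. F (S z \<cdot> x) y) = cnj (sw (\<Delta> \<one>) (\<lambda>x y. cnj (F (star (x \<cdot> star (S z))) (star y))))"
    by (subst Del_one_star) (simp_all add: lin F' star_mul)
  also have "\<dots> = cnj (sw (\<Delta> \<one>) (\<lambda>x y. cnj (F (star x) (star (y \<cdot> star z)))))"
    by (subst Del_one_As_right[OF Sz bilin_cnj_star[OF F]]) (simp add: SS)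
  also have "\<dots> = sw (\<Delta> \<one>) (\<lambda>x y. F x (z \<cdot> y))"
    by (subst (2) Del_one_star) (simp_all add: lin F' star_mul)
  finally show ?thesis by simp
qed

lemma Del_As_right:
  assumes a: "a \<in> As" and F: "bilin F"
  shows "sw (\<Delta> g) (\<lambda>x y. F (x \<cdot> a) y) = sw (\<Delta> g) (\<lambda>x y. F x (y \<cdot> S a))"
proof -
  note F' = bilin_comp[OF F]
  have "sw (\<Delta> g) (\<lambda>x y. F (x \<cdot> a) y) = sw (\<Delta> g) (\<lambda>x y. sw (\<Delta> \<one>) (\<lambda>x' y'. F (x \<cdot> (x' \<cdot> a)) (y \<cdot> y')))"
    using Del_one_right[of "\<lambda>x y. F (x \<cdot> a) y" g] by (simp add: lin F')
  also have "\<dots> = sw (\<Delta> g) (\<lambda>x y. sw (\<Delta> \<one>) (\<lambda>x' y'. F (x \<cdot> x') (y \<cdot> (y' \<cdot> S a))))"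
    by (subst Del_one_As_right[OF a, of "\<lambda>x' y'. F (_ \<cdot> x') (_ \<cdot> y')"]) (simp_all add: lin F')
  also have "\<dots> = sw (\<Delta> g) (\<lambda>x y. F x (y \<cdot> S a))"
    using Del_one_right[of "\<lambda>x y. F x (y \<cdot> S a)" g] by (simp add: lin F')
  finally show ?thesis .
qed

lemma Del_At_left:
  assumes z: "z \<in> At" and F: "bilin F"
  shows "sw (\<Delta> g) (\<lambda>x y. F x (z \<cdot> y)) = sw (\<Delta> g) (\<lambda>x y. F (S z \<cdot> x) y)"
proof -
  note F' = bilin_comp[OF F]
  have "sw (\<Delta> g) (\<lambda>x y. F x (z \<cdot> y)) = sw (\<Delta> \<one>) (\<lambda>x y. sw (\<Delta> g) (\<lambda>x' y'. F (x \<cdot> x') (z \<cdot> y \<cdot> y')))"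
    using Del_one_left[of "\<lambda>x y. F x (z \<cdot> y)" g] by (simp add: lin F')
  also have "\<dots> = sw (\<Delta> \<one>) (\<lambda>x y. sw (\<Delta> g) (\<lambda>x' y'. F (S z \<cdot> x \<cdot> x') (y \<cdot> y')))"
    by (subst Del_one_At_left[OF z, of "\<lambda>x y. sw (\<Delta> g) (\<lambda>x' y'. F (x \<cdot> x') (y \<cdot> y'))"]) (simp_all add: lin F')
  also have "\<dots> = sw (\<Delta> g) (\<lambda>x y. F (S z \<cdot> x) y)"
    using Del_one_left[of "\<lambda>x y. F (S z \<cdot> x) y" g] by (simp add: lin F')
  finally show ?thesis .
qed

text \<open>The tensor term is the coordinate form of \<open>1_2 S(1_1)\<close>.\<close>

lemma fun_unit_S:
  assumes "lin_fun \<phi>"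
  shows "\<phi> (tm (qmul G) (flip (tmap S id (\<Delta> \<one>)))) = sw (\<Delta> \<one>) (\<lambda>a b. \<phi> (b \<cdot> S a))"
  unfolding lin_fun_tm[OF assms] sw_flip
  by (subst sw_tmap) (simp_all add: lin lin_fun_comp[OF assms])

text \<open>Follows for every v from the invariance of \<Delta>(1) under the flipped S \<otimes> S
  and of \<epsilon> under S; the general case enters \<open>eps_S_twisted\<close>.\<close>

lemma eps_s_S: "eps_s G (S v) = S (eps_t G v)"
proof (rule vec_eqI)
  fix \<phi> :: "'i vec \<Rightarrow> complex" assume \<phi>: "lin_fun \<phi>"
  note l = lin lin_fun_comp[OF \<phi>] \<phi>
  have "\<phi> (eps_s G (S v)) = sw (\<Delta> \<one>) (\<lambda>x y. \<phi> (S y) * \<epsilon> (S (x \<cdot> v)))"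
    by (simp add: fun_eps_s[OF \<phi>], subst Del_one_S[symmetric]) (simp_all add: l S_mul)
  also have "\<dots> = \<phi> (S (eps_t G v))"
    by (subst fun_eps_t[of "\<lambda>x. \<phi> (S x)"]) (simp_all add: l eps_S mult.commute)
  finally show "\<phi> (eps_s G (S v)) = \<phi> (S (eps_t G v))" .
qed

lemma eps_eps_s: "\<epsilon> (eps_s G x \<cdot> y) = \<epsilon> (x \<cdot> y)"
  using fun_eps_s[of "\<lambda>z. \<epsilon> (z \<cdot> y)" x] eps_mul_one[of x y]
  by (simp add: lin mult.commute)

end

section \<open>The deformed structure\<close>

text \<open>Here \<open>h\<close> is the inverse of \<open>k\<close>. The locale is entered twice:
  for the given groupoid and, in the duality part, for its dual with the element that corresponds to
  \<open>k\<close>.\<close>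

locale qgk = qg G for G :: "('i::finite) qgroupoid" +
  fixes k h :: "'i vec"
  assumes k_At: "k \<in> At" and k_star: "star k = k"
    and kh [simp]: "k \<cdot> h = \<one>" and hk [simp]: "h \<cdot> k = \<one>"
    and k_sq: "k \<cdot> k = tm (qmul G) (flip (tmap S id (\<Delta> \<one>)))"
begin

lemma h_At: "h \<in> At"
  by (rule At_inverse[OF k_At]) simp_all

lemma h_star: "star h = h"
proof -
  have "star h \<cdot> k = \<one>"
    using star_mul[of k h] by (simp add: k_star)
  then have "star h \<cdot> (k \<cdot> h) = h"
    by (metis assoc one_left)
  then show ?thesis by simp
qed

lemmas Sk_As = S_At_As[OF k_At] and Sh_As = S_At_As[OF h_At]

lemma kh' [simp]: "k \<cdot> (h \<cdot> x) = x" "h \<cdot> (k \<cdot> x) = x"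
  by (simp_all flip: assoc)

lemma Skh [simp]: "S k \<cdot> S h = \<one>" "S h \<cdot> S k = \<one>"
  by (simp_all flip: S_mul)

lemma Skh' [simp]: "S k \<cdot> (S h \<cdot> x) = x" "S h \<cdot> (S k \<cdot> x) = x"
  by (simp_all flip: assoc)

lemmas At_As_simps =
  At_As_commute[OF k_At] At_As_commute[OF h_At]

lemma As_k: "y \<in> As \<Longrightarrow> y \<cdot> (k \<cdot> x) = k \<cdot> (y \<cdot> x)" "y \<in> As \<Longrightarrow> y \<cdot> (h \<cdot> x) = h \<cdot> (y \<cdot> x)"
  by (simp_all add: At_As_simps flip: assoc)

lemmas Sk_commute [simp] =
  At_As_simps(1)[OF Sk_As] At_As_simps(2)[OF Sk_As] At_As_simps(1)[OF Sh_As] At_As_simps(2)[OF Sh_As]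
  As_k(1)[OF Sk_As] As_k(2)[OF Sk_As] As_k(1)[OF Sh_As] As_k(2)[OF Sh_As]

section \<open>The square of the antipode and the inverse of \<open>k \<cdot> k\<close>\<close>

lemma fun_k_sq: "lin_fun \<phi> \<Longrightarrow> sw (\<Delta> \<one>) (\<lambda>a b. \<phi> (b \<cdot> S a)) = \<phi> (k \<cdot> k)"
  unfolding k_sq by (rule fun_unit_S[symmetric])

text \<open>In \<open>z 1_2 S(1_1)\<close> the factor z crosses to the first leg as S(z); since S is
  antimultiplicative it leaves on the right as the second power of S at z.\<close>

lemma At_k_sq: assumes z: "z \<in> At" shows "z \<cdot> (k \<cdot> k) = k \<cdot> (k \<cdot> S (S z))"
proof (rule vec_eqI)
  fix \<phi> :: "'i vec \<Rightarrow> complex" assume \<phi>: "lin_fun \<phi>"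
  note l = lin lin_fun_comp[OF \<phi>] \<phi>
  have "\<phi> (z \<cdot> (k \<cdot> k)) = sw (\<Delta> \<one>) (\<lambda>a b. \<phi> (z \<cdot> b \<cdot> S a))"
    using fun_k_sq[of "\<lambda>x. \<phi> (z \<cdot> x)"] by (simp add: l)
  also have "\<dots> = sw (\<Delta> \<one>) (\<lambda>a b. \<phi> (b \<cdot> S (S z \<cdot> a)))"
    by (rule Del_one_At_left[OF z, of "\<lambda>a b. \<phi> (b \<cdot> S a)"]) (simp add: l)
  also have "\<dots> = \<phi> (k \<cdot> (k \<cdot> S (S z)))"
    using fun_k_sq[of "\<lambda>x. \<phi> (x \<cdot> S (S z))"] by (simp add: l S_mul)
  finally show "\<phi> (z \<cdot> (k \<cdot> k)) = \<phi> (k \<cdot> (k \<cdot> S (S z)))" .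
qed

text \<open>The case z = k of \<open>At_k_sq\<close>, with the invertible square cancelled.\<close>

lemma S_S_k [simp]: "S (S k) = k"
proof -
  have "h \<cdot> (h \<cdot> (k \<cdot> (k \<cdot> S (S k)))) = h \<cdot> (h \<cdot> (k \<cdot> (k \<cdot> k)))"
    using At_k_sq[OF k_At] by simp
  then show ?thesis by simp
qed

lemma S_S_h [simp]: "S (S h) = h"
proof -
  have "h \<cdot> (k \<cdot> S (S h)) = h"
    by (metis S_S_k S_mul S_one assoc kh one_right)
  then show ?thesis by simp
qed

text \<open>Since k is self-adjoint and fixed by the square of S, \<open>S_star_S_star_As\<close> at
  \<open>star (S k)\<close> reduces to this identity.\<close>

lemma star_S_k: "star (S k) = S k"
  using S_star_S_star_As[OF star_As[OF Sk_As]] by (simp add: k_star)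

lemma star_S_h: "star (S h) = S h"
  using S_star_S_star_As[OF star_As[OF Sh_As]] by (simp add: h_star)

lemma eps_Sk_left: "\<epsilon> (S k \<cdot> x) = \<epsilon> (k \<cdot> x)"
  by (rule eps_S_left[OF k_At])

lemma eps_Sk_right: "\<epsilon> (x \<cdot> S k) = \<epsilon> (x \<cdot> k)"
  using eps_S_right[OF Sk_As, of x] by simp

lemma At_k_sq_inv: assumes z: "z \<in> At" shows "h \<cdot> (h \<cdot> z) = S (S z) \<cdot> (h \<cdot> h)"
proof -
  have "h \<cdot> (h \<cdot> (z \<cdot> (k \<cdot> k) \<cdot> (h \<cdot> h))) = h \<cdot> (h \<cdot> (k \<cdot> (k \<cdot> S (S z)) \<cdot> (h \<cdot> h)))"
    by (simp only: At_k_sq[OF z])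
  then show ?thesis by simp
qed

text \<open>Every y in \<open>As\<close> is S(z) for \<open>z = star (S (star y))\<close> in
  \<open>At\<close>, so S can be applied to \<open>At_k_sq\<close>.\<close>

lemma As_k_sq: assumes y: "y \<in> As" shows "S (S y) \<cdot> (S k \<cdot> S k) = S k \<cdot> (S k \<cdot> y)"
proof -
  define z where "z = star (S (star y))"
  have z: "z \<in> At" "S z = y"
    by (simp_all add: z_def star_At S_As_At star_As y S_star_S_star_As)
  show ?thesis
    using arg_cong[OF At_k_sq[OF z(1)], of S] by (simp add: S_mul z(2))
qed

text \<open>Moving the inverse of w to the right of \<open>1_2\<close> applies the square of S to
  \<open>1_2\<close>. After the flip with S \<otimes> S the remaining factor is the square of S at
  w, which is w itself because k is fixed.\<close>

lemma S_h_sq_one: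
  assumes \<phi>: "lin_fun \<phi>"
  shows "sw (\<Delta> \<one>) (\<lambda>a b. \<phi> (S a \<cdot> (h \<cdot> (h \<cdot> b)))) = \<phi> \<one>"
proof -
  note l = lin lin_fun_comp[OF \<phi>] \<phi>
  have "sw (\<Delta> \<one>) (\<lambda>a b. \<phi> (S a \<cdot> (h \<cdot> (h \<cdot> b)))) = sw (\<Delta> \<one>) (\<lambda>a b. \<phi> (S (S b \<cdot> a) \<cdot> (h \<cdot> h)))"
    by (rule Del_one_cong) (simp_all add: l At_k_sq_inv S_mul)
  also have "\<dots> = sw (\<Delta> \<one>) (\<lambda>a b. \<phi> (S (S (b \<cdot> S a)) \<cdot> (h \<cdot> h)))"
    by (subst Del_one_S[symmetric]) (simp_all add: l S_mul)
  also have "\<dots> = \<phi> \<one>"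
    using fun_k_sq[of "\<lambda>x. \<phi> (S (S x) \<cdot> (h \<cdot> h))"] by (simp add: l S_mul)
  finally show ?thesis .
qed

lemma h_sq_S_one:
  assumes \<phi>: "lin_fun \<phi>"
  shows "sw (\<Delta> \<one>) (\<lambda>a b. \<phi> (a \<cdot> (S h \<cdot> (S h \<cdot> S b)))) = \<phi> \<one>"
proof -
  note l = lin lin_fun_comp[OF \<phi>] \<phi>
  have "sw (\<Delta> \<one>) (\<lambda>a b. \<phi> (a \<cdot> (S h \<cdot> (S h \<cdot> S b)))) = sw (\<Delta> \<one>) (\<lambda>a b. \<phi> (S (S a \<cdot> (h \<cdot> (h \<cdot> b)))))"
    by (subst Del_one_S[symmetric]) (simp_all add: l S_mul)
  also have "\<dots> = \<phi> \<one>"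
    using S_h_sq_one[of "\<lambda>x. \<phi> (S x)"] by (simp add: l)
  finally show ?thesis .
qed

text \<open>The first leg of the right copy of \<Delta>(1) lies in \<open>As\<close> and crosses the
  left copy under S; \<open>S_h_sq_one\<close> then contracts it with the second leg.\<close>

lemma Del_one_h_sq:
  assumes F: "bilin F"
  shows "sw (\<Delta> \<one>) (\<lambda>p q. sw (\<Delta> \<one>) (\<lambda>p' q'. F (p \<cdot> p') (q \<cdot> (h \<cdot> (h \<cdot> q'))))) = sw (\<Delta> \<one>) F"
proof -
  note F' = bilin_comp[OF F]
  have "sw (\<Delta> \<one>) (\<lambda>p q. sw (\<Delta> \<one>) (\<lambda>p' q'. F (p \<cdot> p') (q \<cdot> (h \<cdot> (h \<cdot> q')))))
     = sw (\<Delta> \<one>) (\<lambda>p' q'. sw (\<Delta> \<one>) (\<lambda>p q. F (p \<cdot> p') (q \<cdot> (h \<cdot> (h \<cdot> q')))))"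
    by (rule sw_swap)
  also have "\<dots> = sw (\<Delta> \<one>) (\<lambda>p' q'. sw (\<Delta> \<one>) (\<lambda>p q. F p (q \<cdot> (S p' \<cdot> (h \<cdot> (h \<cdot> q'))))))"
  proof (rule Del_one_cong)
    fix p' q' assume "p' \<in> As"
    then show "sw (\<Delta> \<one>) (\<lambda>p q. F (p \<cdot> p') (q \<cdot> (h \<cdot> (h \<cdot> q')))) = sw (\<Delta> \<one>) (\<lambda>p q. F p (q \<cdot> (S p' \<cdot> (h \<cdot> (h \<cdot> q')))))"
      by (subst Del_one_As_right[of p' "\<lambda>p q. F p (q \<cdot> (h \<cdot> (h \<cdot> q')))"]) (simp_all add: lin F')
  qed (simp_all add: lin F')
  also have "\<dots> = sw (\<Delta> \<one>) (\<lambda>p q. sw (\<Delta> \<one>) (\<lambda>p' q'. F p (q \<cdot> (S p' \<cdot> (h \<cdot> (h \<cdot> q'))))))"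
    by (rule sw_swap)
  also have "\<dots> = sw (\<Delta> \<one>) F"
    by (simp add: S_h_sq_one[of "\<lambda>x. F _ (_ \<cdot> x)"] lin F')
  finally show ?thesis .
qed

text \<open>Copies of \<Delta>(1) are inserted on both sides of the factor
  \<open>h \<cdot> h\<close>, where \<open>Del_one_h_sq\<close> removes it.\<close>

lemma Del_mul_h_sq:
  assumes F: "bilin F"
  shows "sw (\<Delta> a) (\<lambda>x y. sw (\<Delta> b) (\<lambda>x' y'. F (x \<cdot> x') (y \<cdot> (h \<cdot> (h \<cdot> y'))))) = sw (\<Delta> (a \<cdot> b)) F"
proof -
  note F' = bilin_comp[OF F]
  have "sw (\<Delta> a) (\<lambda>x y. sw (\<Delta> b) (\<lambda>x' y'. F (x \<cdot> x') (y \<cdot> (h \<cdot> (h \<cdot> y')))))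
    = sw (\<Delta> a) (\<lambda>x y. sw (\<Delta> \<one>) (\<lambda>p q. sw (\<Delta> b) (\<lambda>x' y'. F (x \<cdot> p \<cdot> x') (y \<cdot> q \<cdot> (h \<cdot> (h \<cdot> y'))))))"
    by (subst Del_one_right[of "\<lambda>x y. sw (\<Delta> b) (\<lambda>x' y'. F (x \<cdot> x') (y \<cdot> (h \<cdot> (h \<cdot> y'))))"])
       (simp_all add: lin F')
  also have "\<dots> = sw (\<Delta> a) (\<lambda>x y. sw (\<Delta> \<one>) (\<lambda>p q. sw (\<Delta> \<one>) (\<lambda>p' q'. sw (\<Delta> b)
      (\<lambda>x' y'. F (x \<cdot> p \<cdot> (p' \<cdot> x')) (y \<cdot> q \<cdot> (h \<cdot> (h \<cdot> (q' \<cdot> y'))))))))"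
    by (subst Del_one_left[of "\<lambda>x' y'. F (_ \<cdot> _ \<cdot> x') (_ \<cdot> _ \<cdot> (h \<cdot> (h \<cdot> y')))"]) (simp_all add: lin F')
  also have "\<dots> = sw (\<Delta> a) (\<lambda>x y. sw (\<Delta> \<one>) (\<lambda>p q. sw (\<Delta> b) (\<lambda>x' y'. F (x \<cdot> p \<cdot> x') (y \<cdot> q \<cdot> y'))))"
    using Del_one_h_sq[of "\<lambda>u v. sw (\<Delta> b) (\<lambda>x' y'. F (_ \<cdot> (u \<cdot> x')) (_ \<cdot> (v \<cdot> y')))"]
    by (simp add: lin F')
  also have "\<dots> = sw (\<Delta> a) (\<lambda>x y. sw (\<Delta> b) (\<lambda>x' y'. F (x \<cdot> x') (y \<cdot> y')))"
    by (rule Del_one_right) (simp add: lin F')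
  finally show ?thesis by (simp add: Del_mul[OF F])
qed

section \<open>Deformed counital maps, regularity and the antipode axiom\<close>

abbreviation "H \<equiv> deform G k h"

lemma deform_simps:
  "qmul H = qmul G" "qunit H = \<one>" "qstar H = star"
  "qcounit H a = \<epsilon> (k \<cdot> (a \<cdot> S k))"
  "qanti H a = S h \<cdot> (k \<cdot> (S a \<cdot> (h \<cdot> S k)))"
  by (simp_all add: deform_def Let_def)

lemma deform_comul:
  assumes F: "bilin F"
  shows "sw (qcomul H a) F = sw (\<Delta> a) (\<lambda>x y. F x (h \<cdot> (y \<cdot> h)))"
proof -
  note F' = bilin_comp[OF F]
  have "sw (qcomul H a) F = sw (tens \<one> h) (\<lambda>p q. sw (\<Delta> a) (\<lambda>x y. sw (tens \<one> h) (\<lambda>p' q'. F (p \<cdot> (x \<cdot> p')) (q \<cdot> (y \<cdot> q')))))"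
    by (simp add: deform_def Let_def, subst sw_tmult[OF F], subst sw_tmult) (simp_all add: lin F')
  then show ?thesis by (simp add: sw_tens lin F')
qed

text \<open>Both factors h on the second leg of \<Delta>(1) return to the first leg as S(h). The
  left one cancels k, because \<epsilon> does not distinguish k from S(k) as a left factor. In
  particular the values stay in \<open>At\<close>.\<close>

lemma deform_eps_t: "eps_t H g = eps_t G (S h \<cdot> (g \<cdot> S k))"
proof (rule vec_eqI)
  fix \<phi> :: "'i vec \<Rightarrow> complex" assume \<phi>: "lin_fun \<phi>"
  note l = lin lin_fun_comp[OF \<phi>] \<phi>
  have "\<phi> (eps_t H g) = sw (\<Delta> \<one>) (\<lambda>x y. \<epsilon> (k \<cdot> (x \<cdot> (g \<cdot> S k))) * \<phi> (h \<cdot> (y \<cdot> h)))"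
    unfolding eps_t_def lin_fun_slice_l[OF \<phi>]
    by (subst sw_tmult, simp add: l deform_simps, subst deform_comul)
       (simp_all add: l deform_simps sw_tens)
  also have "\<dots> = sw (\<Delta> \<one>) (\<lambda>x y. \<epsilon> (k \<cdot> (S h \<cdot> (x \<cdot> (g \<cdot> S k)))) * \<phi> (y \<cdot> h))"
    using Del_one_At_left[OF h_At, of "\<lambda>x y. \<epsilon> (k \<cdot> (x \<cdot> (g \<cdot> S k))) * \<phi> (y \<cdot> h)"]
    by (simp add: l)
  also have "\<dots> = sw (\<Delta> \<one>) (\<lambda>x y. \<epsilon> (k \<cdot> (S h \<cdot> (x \<cdot> (S h \<cdot> (g \<cdot> S k))))) * \<phi> y)"
    using Del_one_As_right[OF Sh_As, of "\<lambda>x y. \<epsilon> (k \<cdot> (S h \<cdot> (x \<cdot> (g \<cdot> S k)))) * \<phi> y"]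
    by (simp add: l)
  also have "\<dots> = \<phi> (eps_t G (S h \<cdot> (g \<cdot> S k)))"
    by (simp add: fun_eps_t[OF \<phi>] flip: eps_Sk_left)
  finally show "\<phi> (eps_t H g) = \<phi> (eps_t G (S h \<cdot> (g \<cdot> S k)))" .
qed

lemma deform_eps_s: "eps_s H g = eps_s G (k \<cdot> (g \<cdot> h))"
proof (rule vec_eqI)
  fix \<phi> :: "'i vec \<Rightarrow> complex" assume \<phi>: "lin_fun \<phi>"
  note l = lin lin_fun_comp[OF \<phi>] \<phi>
  have "\<phi> (eps_s H g) = sw (\<Delta> \<one>) (\<lambda>x y. \<phi> x * \<epsilon> (k \<cdot> (g \<cdot> (h \<cdot> (y \<cdot> (h \<cdot> S k))))))"
    unfolding eps_s_def lin_fun_slice_r[OF \<phi>]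
    by (subst sw_tmult, simp add: l deform_simps, subst sw_tens, simp add: l deform_simps, subst deform_comul)
       (simp_all add: l deform_simps)
  also have "\<dots> = sw (\<Delta> \<one>) (\<lambda>x y. \<phi> x * \<epsilon> (k \<cdot> (g \<cdot> (h \<cdot> y))))"
    using eps_Sk_right[of "k \<cdot> (g \<cdot> (h \<cdot> (_ \<cdot> h)))"] by simp
  finally show "\<phi> (eps_s H g) = \<phi> (eps_s G (k \<cdot> (g \<cdot> h)))"
    by (simp add: fun_eps_s[OF \<phi>])
qed

text \<open>On \<open>At\<close> the factors S(h) and S(k) commute past and cancel, and conjugation
  by the square of k undoes the square of S. On \<open>As\<close> the roles of k and S(k) are
  exchanged.\<close>

lemma regular_deform: "regular H"
proof -
  have SS: "qanti H (qanti H x) = k \<cdot> (k \<cdot> (S h \<cdot> (S h \<cdot> (S (S x) \<cdot> (h \<cdot> (h \<cdot> (S k \<cdot> S k)))))))" for x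
    by (simp add: deform_simps S_mul)
  have t: "qanti H (qanti H z) = z" if z: "z \<in> At" for z
  proof -
    have c: "y \<cdot> S (S z) = S (S z) \<cdot> y" "y \<cdot> (S (S z) \<cdot> x) = S (S z) \<cdot> (y \<cdot> x)" if "y \<in> As" for y x
      using At_As_commute[OF S_As_At[OF S_At_As[OF z]] that] by (simp_all flip: assoc)
    have "qanti H (qanti H z) = k \<cdot> (k \<cdot> S (S z)) \<cdot> (h \<cdot> h)"
      by (simp add: SS c[OF Sh_As])
    also have "\<dots> = z \<cdot> (k \<cdot> k) \<cdot> (h \<cdot> h)" by (simp only: At_k_sq[OF z])
    finally show ?thesis by simp
  qed
  have s: "qanti H (qanti H y) = y" if y: "y \<in> As" for y
  proof -
    have SSy: "S (S y) \<in> As" by (simp add: y S_As_At S_At_As)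
    have "qanti H (qanti H y) = S h \<cdot> (S h \<cdot> (S (S y) \<cdot> (S k \<cdot> S k)))"
      by (simp add: SS As_k[OF SSy])
    then show ?thesis by (simp add: As_k_sq[OF y])
  qed
  show ?thesis
    by (auto simp: regular_def deform_eps_t deform_eps_s t s)
qed

lemma deform_antipode: "tm (qmul G) (tmap id (qanti H) (qcomul H g)) = eps_t H g"
proof (rule vec_eqI)
  fix \<phi> :: "'i vec \<Rightarrow> complex" assume \<phi>: "lin_fun \<phi>"
  note l = lin lin_fun_comp[OF \<phi>] \<phi>
  have "\<phi> (tm (qmul G) (tmap id (qanti H) (qcomul H g)))
      = sw (\<Delta> g) (\<lambda>x y. \<phi> (x \<cdot> (k \<cdot> (S h \<cdot> (S h \<cdot> (S y \<cdot> h))))))"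
    by (simp add: lin_fun_tm[OF \<phi>], subst sw_tmap, simp add: l, subst deform_comul)
       (simp_all add: l deform_simps S_mul)
  \<comment> \<open>A copy of \<Delta>(1) is inserted on the right of \<Delta>(g); its legs enclose
    the square of S(h) and collapse with it by \<open>h_sq_S_one\<close>.\<close>
  also have "\<dots> = sw (\<Delta> g) (\<lambda>x y. sw (\<Delta> \<one>) (\<lambda>p q. \<phi> (x \<cdot> (p \<cdot> (k \<cdot> (S h \<cdot> (S h \<cdot> (S q \<cdot> (S y \<cdot> h)))))))))"
    using Del_one_right[of "\<lambda>x y. \<phi> (x \<cdot> (k \<cdot> (S h \<cdot> (S h \<cdot> (S y \<cdot> h)))))" g] by (simp add: l S_mul)
  also have "\<dots> = sw (\<Delta> g) (\<lambda>x y. \<phi> (x \<cdot> (k \<cdot> (S y \<cdot> h))))"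
  proof -
    have "sw (\<Delta> \<one>) (\<lambda>p q. \<phi> (x \<cdot> (p \<cdot> (k \<cdot> (S h \<cdot> (S h \<cdot> (S q \<cdot> (S y \<cdot> h)))))))) = 
        sw (\<Delta> \<one>) (\<lambda>p q. \<phi> (x \<cdot> (k \<cdot> (p \<cdot> (S h \<cdot> (S h \<cdot> (S q \<cdot> (S y \<cdot> h))))))))" for x y
      by (rule Del_one_cong) (simp_all add: l As_k)
    also have "\<dots> x y = \<phi> (x \<cdot> (k \<cdot> (S y \<cdot> h)))" for x y
      using h_sq_S_one[of "\<lambda>v. \<phi> (x \<cdot> (k \<cdot> (v \<cdot> (S y \<cdot> h))))"] by (simp add: l)
    finally show ?thesis by simp
  qed
  also have "\<dots> = sw (\<Delta> (S h \<cdot> (g \<cdot> S k))) (\<lambda>x y. \<phi> (x \<cdot> S y))"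
    by (subst Del_As_mul(1)[OF Sh_As], simp add: l, subst Del_As_mul(2)[OF Sk_As]) (simp_all add: l S_mul)
  also have "\<dots> = \<phi> (eps_t H g)" by (simp add: deform_eps_t fun_eps_t_S[OF \<phi>])
  finally show "\<phi> (tm (qmul G) (tmap id (qanti H) (qcomul H g))) = \<phi> (eps_t H g)" .
qed

section \<open>The remaining axioms of the deformed groupoid\<close>

lemma deform_eps_eq: "\<epsilon> (k \<cdot> (a \<cdot> S k)) = \<epsilon> (S k \<cdot> (a \<cdot> k))"
  using eps_Sk_right[of "k \<cdot> a"] by (simp add: eps_Sk_left)

lemma lin_deform_comul: "lin_map (qcomul H)"
proof -
  have "bilin (\<lambda>x y. x i * y j)" for i j :: 'i
    by (intro bilinI lin_fun_times lin_fun_coord)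
  note * = deform_comul[OF this]
  have "lin_fun (\<lambda>a. sw (qcomul H a) (\<lambda>x y. x i * y j))" for i j
    unfolding * by (simp add: lin)
  moreover have "sw t (\<lambda>x y. x i * y j) = t (i, j)" for t :: "('i \<times> 'i) vec" and i j
    by (rule sw_coord)
  ultimately show ?thesis
    by (simp add: lin_map_def lin_fun_def fun_eq_iff vadd_def smul_def)
qed

text \<open>The inner factors h of the two coproducts meet as \<open>h \<cdot> h\<close>, which
  \<open>Del_mul_h_sq\<close> absorbs.\<close>

lemma deform_comul_mul: "qcomul H (a \<cdot> b) = tmult (qmul G) (qmul G) (qcomul H a) (qcomul H b)"
proof (rule tens_eqI)
  fix F :: "'i vec \<Rightarrow> 'i vec \<Rightarrow> complex" assume F: "bilin F"
  note F' = bilin_comp[OF F]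
  have "sw (tmult (qmul G) (qmul G) (qcomul H a) (qcomul H b)) F
    = sw (\<Delta> a) (\<lambda>x y. sw (\<Delta> b) (\<lambda>x' y'. F (x \<cdot> x') (h \<cdot> (y \<cdot> (h \<cdot> (h \<cdot> (y' \<cdot> h)))))))"
    by (simp add: sw_tmult[OF F] deform_comul lin F')
  also have "\<dots> = sw (\<Delta> (a \<cdot> b)) (\<lambda>x y. F x (h \<cdot> (y \<cdot> h)))"
    using Del_mul_h_sq[of "\<lambda>x y. F x (h \<cdot> (y \<cdot> h))" a b] by (simp add: lin F')
  finally show "sw (qcomul H (a \<cdot> b)) F = sw (tmult (qmul G) (qmul G) (qcomul H a) (qcomul H b)) F"
    by (simp add: deform_comul[OF F])
qed

lemma deform_comul_star: "qcomul H (star a) = tstar star star (qcomul H a)"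
proof (rule tens_eqI)
  fix F :: "'i vec \<Rightarrow> 'i vec \<Rightarrow> complex" assume F: "bilin F"
  note F' = bilin_comp[OF F]
  show "sw (qcomul H (star a)) F = sw (tstar star star (qcomul H a)) F"
    by (simp add: sw_tstar[OF F] deform_comul[OF F] deform_comul[OF bilin_cnj_star[OF F]])
       (subst Del_star, simp_all add: lin F' star_mul h_star)
qed

text \<open>Since h lies in \<open>At\<close>, a coproduct applied to a second leg carries the
  adjacent factors h only to its own first leg. Both sides thus become the double coproduct
  multiplied on either side by 1 \<otimes> h \<otimes> h.\<close>

lemma deform_coassoc: "reassoc (tmap (qcomul H) id (qcomul H a)) = tmap id (qcomul H) (qcomul H a)"
proof (rule sw3_eqI)
  fix F :: "'i vec \<Rightarrow> 'i vec \<Rightarrow> 'i vec \<Rightarrow> complex" assume F: "trilin F"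
  note F' = trilin_comp[OF F]
  have "sw3 (reassoc (tmap (qcomul H) id (qcomul H a))) F
     = sw (\<Delta> a) (\<lambda>p z. sw (\<Delta> p) (\<lambda>x y. F x (h \<cdot> (y \<cdot> h)) (h \<cdot> (z \<cdot> h))))"
    by (simp add: sw3_coassoc_left[OF F] deform_comul lin F')
  also have "\<dots> = sw (\<Delta> a) (\<lambda>x q. sw (\<Delta> q) (\<lambda>y z. F x (h \<cdot> (y \<cdot> h)) (h \<cdot> (z \<cdot> h))))"
    by (rule coassoc) (simp add: lin F')
  also have "\<dots> = sw3 (tmap id (qcomul H) (qcomul H a)) F"
    by (simp add: sw3_coassoc_right[OF F] deform_comul lin F' Del_At_mul[OF h_At])
  finally show "sw3 (reassoc (tmap (qcomul H) id (qcomul H a))) F = sw3 (tmap id (qcomul H) (qcomul H a)) F" .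
qed

lemma deform_comul_one:
  "reassoc (tmap (qcomul H) id (qcomul H \<one>))
     = tmult (qmul G) (tmult (qmul G) (qmul G)) (tens \<one> (qcomul H \<one>)) (reassoc (tens (qcomul H \<one>) \<one>))"
proof (rule sw3_eqI)
  fix F :: "'i vec \<Rightarrow> 'i vec \<Rightarrow> 'i vec \<Rightarrow> complex" assume F: "trilin F"
  note F' = trilin_comp[OF F]
  have "sw3 (reassoc (tmap (qcomul H) id (qcomul H \<one>))) F
     = sw (\<Delta> \<one>) (\<lambda>p z. sw (\<Delta> p) (\<lambda>x y. F x (h \<cdot> (y \<cdot> h)) (h \<cdot> (z \<cdot> h))))"
    by (simp add: sw3_coassoc_left[OF F] deform_comul lin F')
  also have "\<dots> = sw (\<Delta> \<one>) (\<lambda>c d. sw (\<Delta> \<one>) (\<lambda>a b. F c (h \<cdot> (a \<cdot> (d \<cdot> h))) (h \<cdot> (b \<cdot> h))))"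
    by (subst Del_Del_one) (simp_all add: lin F')
  also have "\<dots> = sw (\<Delta> \<one>) (\<lambda>c d. sw (\<Delta> \<one>) (\<lambda>a b. F c (a \<cdot> (h \<cdot> (d \<cdot> h))) (h \<cdot> (b \<cdot> h))))"
  proof -
    \<comment> \<open>The first leg a lies in \<open>As\<close> and therefore commutes with
      h.\<close>
    have "sw (\<Delta> \<one>) (\<lambda>a b. F c (h \<cdot> (a \<cdot> (d \<cdot> h))) (h \<cdot> (b \<cdot> h))) = sw (\<Delta> \<one>) (\<lambda>a b. F c (a \<cdot> (h \<cdot> (d \<cdot> h))) (h \<cdot> (b \<cdot> h)))" for c d
      by (rule Del_one_cong) (simp_all add: lin F' As_k)
    then show ?thesis by simp
  qed
  also have "\<dots> = sw3 (tmult (qmul G) (tmult (qmul G) (qmul G)) (tens \<one> (qcomul H \<one>)) (reassoc (tens (qcomul H \<one>) \<one>))) F"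
    by (simp add: sw3_unit_product[OF F] deform_comul lin F')
  finally show "sw3 (reassoc (tmap (qcomul H) id (qcomul H \<one>))) F = \<dots>" .
qed

text \<open>S(k) crosses to the second leg as k and cancels the right h; the left h crosses to the
  first leg as S(h) and cancels k, read as S(k) under the counit.\<close>

lemma deform_counit_left: "slice_l (qcounit H) (qcomul H a) = a"
proof (rule vec_eqI)
  fix \<phi> :: "'i vec \<Rightarrow> complex" assume \<phi>: "lin_fun \<phi>"
  note l = lin lin_fun_comp[OF \<phi>] \<phi>
  have "\<phi> (slice_l (qcounit H) (qcomul H a)) = sw (\<Delta> a) (\<lambda>x y. \<epsilon> (k \<cdot> (x \<cdot> S k)) * \<phi> (h \<cdot> (y \<cdot> h)))"
    by (simp add: lin_fun_slice_l[OF \<phi>] deform_comul deform_simps l)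
  also have "\<dots> = sw (\<Delta> a) (\<lambda>x y. \<epsilon> (k \<cdot> x) * \<phi> (h \<cdot> y))"
    by (subst Del_As_right[OF Sk_As, of "\<lambda>x y. \<epsilon> (k \<cdot> x) * \<phi> (h \<cdot> (y \<cdot> h))"]) (simp_all add: l)
  also have "\<dots> = sw (\<Delta> a) (\<lambda>x y. \<epsilon> (k \<cdot> (S h \<cdot> x)) * \<phi> y)"
    by (rule Del_At_left[OF h_At, of "\<lambda>x y. \<epsilon> (k \<cdot> x) * \<phi> y"]) (simp add: l)
  also have "\<dots> = \<phi> a" by (simp add: counit_left[OF \<phi>] flip: eps_Sk_left)
  finally show "\<phi> (slice_l (qcounit H) (qcomul H a)) = \<phi> a" .
qed

lemma deform_counit_right: "slice_r (qcounit H) (qcomul H a) = a"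
proof (rule vec_eqI)
  fix \<phi> :: "'i vec \<Rightarrow> complex" assume \<phi>: "lin_fun \<phi>"
  note l = lin lin_fun_comp[OF \<phi>] \<phi>
  have "\<phi> (slice_r (qcounit H) (qcomul H a)) = sw (\<Delta> a) (\<lambda>x y. \<phi> x * \<epsilon> (y \<cdot> h \<cdot> S k))"
    by (simp add: lin_fun_slice_r[OF \<phi>] deform_comul deform_simps l)
  also have "\<dots> = \<phi> a" by (simp only: eps_Sk_right) (simp add: counit_right[OF \<phi>])
  finally show "\<phi> (slice_r (qcounit H) (qcomul H a)) = \<phi> a" .
qed

text \<open>Once S(k) has crossed to the second leg and cancelled h, \<open>eps_mul\<close> applies
  with outer factors \<open>k \<cdot> f\<close> and \<open>f' \<cdot> S k\<close>.\<close>

lemma deform_counit_mul: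
  "qcounit H (f \<cdot> (g \<cdot> f')) = tfun (\<lambda>x. qcounit H (f \<cdot> x)) (\<lambda>y. qcounit H (y \<cdot> f')) (qcomul H g)"
proof -
  have "tfun (\<lambda>x. qcounit H (f \<cdot> x)) (\<lambda>y. qcounit H (y \<cdot> f')) (qcomul H g)
    = sw (\<Delta> g) (\<lambda>x y. \<epsilon> (k \<cdot> (f \<cdot> (x \<cdot> S k))) * \<epsilon> (y \<cdot> (h \<cdot> (f' \<cdot> S k))))"
    by (simp add: tfun_sw deform_comul deform_simps lin)
  also have "\<dots> = sw (\<Delta> g) (\<lambda>x y. \<epsilon> (k \<cdot> f \<cdot> x) * \<epsilon> (y \<cdot> (f' \<cdot> S k)))"
    by (subst Del_As_right[OF Sk_As, of "\<lambda>x y. \<epsilon> (k \<cdot> (f \<cdot> x)) * \<epsilon> (y \<cdot> (h \<cdot> (f' \<cdot> S k)))"]) (simp_all add: lin)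
  also have "\<dots> = qcounit H (f \<cdot> (g \<cdot> f'))"
    by (simp only: eps_mul[symmetric]) (simp add: deform_simps)
  finally show ?thesis by simp
qed

lemma lin_deform_anti: "lin_map (qanti H)"
  unfolding deform_simps by (simp add: lin)

lemma deform_anti_mul: "qanti H (a \<cdot> b) = qanti H b \<cdot> qanti H a"
  by (simp add: deform_simps S_mul)

lemma deform_comul_anti: "qcomul H (qanti H a) = flip (tmap (qanti H) (qanti H) (qcomul H a))"
proof (rule tens_eqI)
  fix F :: "'i vec \<Rightarrow> 'i vec \<Rightarrow> complex" assume F: "bilin F"
  note F' = bilin_comp[OF F]
  have "sw (flip (tmap (qanti H) (qanti H) (qcomul H a))) F
    = sw (\<Delta> a) (\<lambda>x y. F (k \<cdot> (S h \<cdot> (S h \<cdot> (S y \<cdot> h)))) (k \<cdot> (S h \<cdot> (S x \<cdot> (h \<cdot> S k)))))"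
    by (simp add: sw_flip sw_tmap deform_comul lin F')
       (simp add: deform_simps S_mul deform_comul lin F')
  also have "\<dots> = sw (\<Delta> (S a)) (\<lambda>x y. F (k \<cdot> (S h \<cdot> (S h \<cdot> (x \<cdot> h)))) (k \<cdot> (S h \<cdot> (y \<cdot> (h \<cdot> S k)))))"
    by (subst Del_S) (simp_all add: lin F')
  \<comment> \<open>Both factors S(h) on the first leg cross to the second as h: one cancels k
    there, the other becomes the left factor h of the deformed coproduct.\<close>
  also have "\<dots> = sw (\<Delta> (S a)) (\<lambda>x y. F (k \<cdot> (x \<cdot> h)) (h \<cdot> (S h \<cdot> (y \<cdot> (h \<cdot> S k)))))"
  proof -
    have "sw (\<Delta> (S a)) (\<lambda>x y. F (k \<cdot> (S h \<cdot> (x \<cdot> h))) (S h \<cdot> (y \<cdot> (h \<cdot> S k))))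
       = sw (\<Delta> (S a)) (\<lambda>x y. F (k \<cdot> (x \<cdot> h)) (h \<cdot> (S h \<cdot> (y \<cdot> (h \<cdot> S k)))))"
      using Del_At_left[OF h_At, of "\<lambda>x y. F (k \<cdot> (x \<cdot> h)) (S h \<cdot> (y \<cdot> (h \<cdot> S k)))" "S a"] by (simp add: lin F')
    then show ?thesis
      using Del_At_left[OF h_At, of "\<lambda>x y. F (k \<cdot> (S h \<cdot> (x \<cdot> h))) (k \<cdot> (S h \<cdot> (y \<cdot> (h \<cdot> S k))))" "S a"]
      by (simp add: lin F')
  qed
  also have "\<dots> = sw (qcomul H (qanti H a)) F"
  proof -
    have "sw (\<Delta> (S a \<cdot> (h \<cdot> S k))) E = sw (\<Delta> (S a)) (\<lambda>x y. E (x \<cdot> h) (y \<cdot> S k))" if "bilin E" for E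
      using Del_As_mul(2)[OF Sk_As that, of "S a \<cdot> h"]
      by (simp add: Del_At_mul(2)[OF h_At] lin bilin_comp[OF that])
    then show ?thesis
      by (simp add: deform_comul[OF F] deform_simps Del_At_mul[OF k_At] Del_As_mul[OF Sh_As] lin F')
  qed
  finally show "sw (qcomul H (qanti H a)) F = sw (flip (tmap (qanti H) (qanti H) (qcomul H a))) F" by simp
qed

lemma deform_counit_anti: "qcounit H (qanti H a) = qcounit H a"
proof -
  have "qcounit H (qanti H a) = \<epsilon> (k \<cdot> (S h \<cdot> (k \<cdot> (S a \<cdot> (S k \<cdot> (h \<cdot> S k))))))"
    by (simp add: deform_simps)
  also have "\<dots> = \<epsilon> (k \<cdot> (S a \<cdot> (S k \<cdot> (h \<cdot> S k))))"
    by (subst eps_Sk_left[symmetric]) simp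
  also have "\<dots> = \<epsilon> (k \<cdot> (S a \<cdot> S k))"
    using eps_Sk_right[of "k \<cdot> (S a \<cdot> (S k \<cdot> h))"] by simp
  also have "\<dots> = \<epsilon> (S (k \<cdot> (a \<cdot> k)))"
    by (subst eps_Sk_left[symmetric]) (simp add: S_mul)
  also have "\<dots> = qcounit H a"
    using eps_Sk_right[of "k \<cdot> a"] by (simp add: eps_S deform_simps)
  finally show ?thesis .
qed

lemma fin_cqg_deform: "fin_cqg H"
proof -
  have "lin_fun (qcounit H)" unfolding deform_simps by (simp add: lin)
  then show ?thesis
    unfolding fin_cqg_def Let_def deform_simps(1-3)
    using cstar lin_deform_comul deform_comul_mul deform_comul_star deform_coassoc deform_comul_one
      deform_counit_left deform_counit_right deform_counit_mul lin_deform_anti deform_anti_mul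
      deform_comul_anti deform_counit_anti deform_antipode
    by blast
qed

text \<open>The left side is the pairing of a with \<open>1_2 S(1_1)\<close> of a dual groupoid, so
  this identifies that element of the dual with the functional given by the square of k.\<close>

lemma eps_S_twisted: "sw (\<Delta> a) (\<lambda>x y. \<epsilon> (S y \<cdot> x)) = \<epsilon> (k \<cdot> (k \<cdot> a))"
proof -
  have "sw (\<Delta> a) (\<lambda>x y. \<epsilon> (S y \<cdot> x)) = sw (\<Delta> a) (\<lambda>x y. \<epsilon> (S (eps_t G y) \<cdot> x))"
    by (simp add: eps_eps_s flip: eps_s_S)
  also have "\<dots> = sw (\<Delta> \<one>) (\<lambda>x y. \<epsilon> (S y \<cdot> (x \<cdot> a)))"
    by (rule Del_eps_t) (simp add: lin)
  also have "\<dots> = sw (\<Delta> \<one>) (\<lambda>x y. \<epsilon> (S (y \<cdot> S x) \<cdot> a))"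
    by (subst Del_one_S[symmetric]) (simp_all add: lin S_mul)
  also have "\<dots> = \<epsilon> (S (k \<cdot> k) \<cdot> a)"
    by (rule fun_k_sq[of "\<lambda>x. \<epsilon> (S x \<cdot> a)"]) (simp add: lin)
  also have "\<dots> = \<epsilon> (k \<cdot> (k \<cdot> a))"
    by (subst eps_S_left) (simp_all add: At_mul k_At)
  finally show ?thesis .
qed

text \<open>S(k) crosses from the first leg and cancels h; the outer k and S(k) are then absorbed
  into the coproduct. With \<open>p\<close> and \<open>bc\<close> arbitrary, the lemma serves the
  pairing and its transpose alike.\<close>

lemma deform_pairing:
  assumes p: "bilin p"
    and mul: "\<And>a. p a bc = sw (\<Delta> a) (\<lambda>x y. p x b * p y c)"
  shows "sw (qcomul H a) (\<lambda>x y. p (k \<cdot> (x \<cdot> S k)) b * p (k \<cdot> (y \<cdot> S k)) c) = p (k \<cdot> (a \<cdot> S k)) bc"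
proof -
  note p' = bilin_comp[OF p]
  have "sw (qcomul H a) (\<lambda>x y. p (k \<cdot> (x \<cdot> S k)) b * p (k \<cdot> (y \<cdot> S k)) c)
    = sw (\<Delta> a) (\<lambda>x y. p (k \<cdot> (x \<cdot> S k)) b * p (y \<cdot> (h \<cdot> S k)) c)"
    by (simp add: deform_comul lin p')
  also have "\<dots> = sw (\<Delta> a) (\<lambda>x y. p (k \<cdot> x) b * p (y \<cdot> S k) c)"
    using Del_As_right[OF Sk_As, of "\<lambda>x y. p (k \<cdot> x) b * p (y \<cdot> (h \<cdot> S k)) c" a] by (simp add: lin p')
  also have "\<dots> = sw (\<Delta> (k \<cdot> (a \<cdot> S k))) (\<lambda>x y. p x b * p y c)"
    by (simp add: Del_At_mul(1)[OF k_At] Del_As_mul(2)[OF Sk_As] lin p')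
  finally show ?thesis by (simp add: mul)
qed

end

section \<open>Duality\<close>

locale qpair = A: qgk A k h + B: qg B
  for A :: "('i::finite) qgroupoid" and k h :: "'i vec" and B :: "('j::finite) qgroupoid" +
  fixes p :: "'i vec \<Rightarrow> 'j vec \<Rightarrow> complex"
  assumes dual: "dual_pair A B p"
begin

abbreviation mulA (infixl "\<odot>" 70) where "x \<odot> y \<equiv> qmul A x y"
abbreviation mulB (infixl "\<otimes>" 70) where "x \<otimes> y \<equiv> qmul B x y"

lemma p_bilin: "bilin p"
  and p_anti: "p (qanti A a) b = p a (qanti B b)"
  and p_star: "p a (qstar B b) = cnj (p (qstar A (qanti A a)) b)"
  and p_one_B: "p a (qunit B) = qcounit A a"
  and p_one_A: "p (qunit A) b = qcounit B b"
  and p_mul_B_ptens: "p a (b \<otimes> c) = ptens p (qcomul A a) (tens b c)"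
  and p_mul_A_ptens: "p (a \<odot> a') b = ptens p (tens a a') (qcomul B b)"
  and p_zero_A: "\<forall>b. p a b = 0 \<Longrightarrow> a = vzero"
  and p_zero_B: "\<forall>a. p a b = 0 \<Longrightarrow> b = vzero"
  using dual unfolding dual_pair_def bilin_def by iprover+

lemmas p_lin = bilin_comp[OF p_bilin]

lemma p_mul_B: "p a (b \<otimes> c) = sw (qcomul A a) (\<lambda>x y. p x b * p y c)"
  unfolding p_mul_B_ptens by (rule ptens_tens_right[OF p_bilin])

lemma p_mul_A: "p (a \<odot> a') b = sw (qcomul B b) (\<lambda>x y. p a x * p a' y)"
  unfolding p_mul_A_ptens by (rule ptens_tens_left[OF p_bilin])

lemma p_eq_A: assumes "\<And>b. p x b = p y b" shows "x = y"
proof -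
  have "p (vadd x (smul (-1) y)) b = 0" for b
    using assms p_bilin by (intro lin_fun_eqD[of "\<lambda>x. p x b"]) (simp_all add: bilin_def)
  then show ?thesis by (rule vadd_minus_eq_zero[OF p_zero_A, rule_format])
qed

lemma p_eq_B: assumes "\<And>a. p a x = p a y" shows "x = y"
proof -
  have "p a (vadd x (smul (-1) y)) = 0" for a
    using assms p_bilin by (intro lin_fun_eqD[of "p a"]) (simp_all add: bilin_def)
  then show ?thesis by (rule vadd_minus_eq_zero[OF p_zero_B, rule_format])
qed

text \<open>The element of \<open>B\<^sub>t\<close> that represents the functional \<open>a \<mapsto> \<epsilon>(z a)\<close>.\<close>
definition bet :: "'i vec \<Rightarrow> 'j vec" where
  "bet z = slice_l (p z) (qcomul B (qunit B))"

lemma p_bet: "p a (bet z) = qcounit A (z \<odot> a)"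
proof -
  have "lin_fun (p a)" using p_bilin by (simp add: bilin_def)
  then show ?thesis
    by (simp add: bet_def lin_fun_slice_l p_mul_A[symmetric] p_one_B)
qed

lemma bet_At: "bet z \<in> B.At"
proof (rule B.At_I, rule vec_eqI)
  fix \<phi> :: "'j vec \<Rightarrow> complex" assume \<phi>: "lin_fun \<phi>"
  note l = lin lin_fun_comp[OF \<phi>] \<phi> p_lin
  have \<phi>2: "lin_fun (\<lambda>x. \<phi> (eps_t B x))" by (simp add: l)
  have "sw (qcomul B (qunit B)) (\<lambda>a b. p z a * \<phi> (eps_t B b)) = sw (qcomul B (qunit B)) (\<lambda>a b. p z a * \<phi> b)"
  proof (rule B.Del_one_cong)
    show "bilin (\<lambda>a b. p z a * \<phi> (eps_t B b))" by (simp add: l)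
    show "bilin (\<lambda>a b. p z a * \<phi> b)" by (simp add: l)
  qed (simp only: B.eps_t_At)
  then show "\<phi> (eps_t B (bet z)) = \<phi> (bet z)"
    by (simp only: bet_def lin_fun_slice_l[OF \<phi>] lin_fun_slice_l[OF \<phi>2])
qed

text \<open>This and the next lemmas transpose multiplication by \<open>bet z\<close> and by its
  antipode to multiplication in A: the counit contracts one leg of \<Delta>(a) once z has been
  absorbed into the coproduct.\<close>

lemma p_bet_left: "z \<in> A.At \<Longrightarrow> p a (bet z \<otimes> b) = p (z \<odot> a) b"
  using A.counit_left[of "\<lambda>x. p x b" "z \<odot> a"]
  by (simp add: p_mul_B p_bet A.Del_At_mul lin A.lin_eps p_lin)

lemma p_bet_right: "z \<in> A.At \<Longrightarrow> p a (b \<otimes> bet z) = p (qanti A z \<odot> a) b"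
  using A.counit_right[of "\<lambda>x. p x b" "qanti A z \<odot> a"]
  by (simp add: p_mul_B p_bet A.Del_As_mul A.S_At_As lin A.lin_eps p_lin A.eps_S_left)

lemma p_S_bet: "z \<in> A.At \<Longrightarrow> p a (qanti B (bet z)) = qcounit A (a \<odot> z)"
  using A.eps_S_left[of z "qanti A a"] A.eps_S[of "a \<odot> z"]
  by (simp add: p_anti[symmetric] p_bet A.S_mul)

lemma p_S_bet_left: "z \<in> A.At \<Longrightarrow> p a (qanti B (bet z) \<otimes> b) = p (a \<odot> z) b"
  using A.counit_left[of "\<lambda>x. p x b" "a \<odot> z"]
  by (simp add: p_mul_B p_S_bet A.Del_At_mul lin A.lin_eps p_lin)

lemma p_S_bet_right:
  assumes z: "z \<in> A.At" and SS: "qanti A (qanti A z) = z"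
  shows "p a (b \<otimes> qanti B (bet z)) = p (a \<odot> qanti A z) b"
  \<comment> \<open>The assumption \<open>SS\<close> lets \<open>A.eps_S_right\<close> replace z by
    S(z), an element of \<open>As\<close> that can be absorbed through the second leg.\<close>
  using A.counit_right[of "\<lambda>x. p x b" "a \<odot> qanti A z"] A.eps_S_right[of "qanti A z"]
  by (simp add: p_mul_B p_S_bet[OF z] A.Del_As_mul A.S_At_As[OF z] lin A.lin_eps p_lin SS)

text \<open>The functional \<epsilon>(k a) represents in B the element that deforms B, so every
  result on the deformation of A becomes available for B.\<close>

sublocale B': qgk B "bet k" "bet h"
proof
  show "bet k \<in> B.At" by (rule bet_At)
  show "qstar B (bet k) = bet k"
  proof (rule p_eq_B)
    fix a
    have "p a (qstar B (bet k)) = qcounit A (qanti A a \<odot> k)"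
      by (simp add: p_star p_bet A.eps_star[symmetric] A.star_mul A.k_star)
    also have "\<dots> = qcounit A (k \<odot> a)"
      using A.eps_S[of "k \<odot> a"] by (simp add: A.S_mul A.eps_Sk_right)
    finally show "p a (qstar B (bet k)) = p a (bet k)" by (simp add: p_bet)
  qed
  show "bet k \<otimes> bet h = qunit B" "bet h \<otimes> bet k = qunit B"
    by (rule p_eq_B, simp add: p_bet_left A.k_At A.h_At p_bet p_one_B)+
  show "bet k \<otimes> bet k = tm (qmul B) (flip (tmap (qanti B) id (qcomul B (qunit B))))"
  proof (rule p_eq_B)
    fix a
    have "lin_fun (p a)" using p_bilin by (simp add: bilin_def)
    then have "p a (tm (qmul B) (flip (tmap (qanti B) id (qcomul B (qunit B)))))
      = sw (qcomul B (qunit B)) (\<lambda>x y. p a (y \<otimes> qanti B x))"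
      by (rule B.fun_unit_S)
    \<comment> \<open>The pairing turns the product in B into \<Delta>(a); with the sums exchanged,
      the coproduct of the unit of B becomes a product in A.\<close>
    also have "\<dots> = sw (qcomul A a) (\<lambda>u v. sw (qcomul B (qunit B)) (\<lambda>x y. p (qanti A v) x * p u y))"
      unfolding p_mul_B p_anti by (subst sw_swap) (simp add: mult.commute)
    also have "\<dots> = sw (qcomul A a) (\<lambda>u v. qcounit A (qanti A v \<odot> u))"
      by (simp add: p_mul_A[symmetric] p_one_B)
    also have "\<dots> = p a (bet k \<otimes> bet k)"
      by (simp add: A.eps_S_twisted p_bet_left A.k_At p_bet)
    finally show "p a (bet k \<otimes> bet k) = p a (tm (qmul B) (flip (tmap (qanti B) id (qcomul B (qunit B)))))"
      by simp
  qed
qed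

section \<open>The deformed pairing\<close>

definition q where "q a b = p (k \<odot> (a \<odot> qanti A k)) b"

text \<open>The pairing has the same shape when its deformation is read in B, which gives the
  symmetry between A and B used below.\<close>

lemma q_alt: "q a b = p a (bet k \<otimes> (b \<otimes> qanti B (bet k)))"
  by (simp add: q_def p_bet_left p_S_bet_right A.k_At)

lemma q_bilin: "bilin q"
  unfolding q_def by (simp add: lin p_lin)

lemma q_eq_A: assumes "\<And>b. q x b = q y b" shows "x = y"
proof -
  have "k \<odot> (x \<odot> qanti A k) = k \<odot> (y \<odot> qanti A k)"
    using assms by (intro p_eq_A) (simp add: q_def)
  then have "h \<odot> (k \<odot> (x \<odot> qanti A k)) \<odot> qanti A h = h \<odot> (k \<odot> (y \<odot> qanti A k)) \<odot> qanti A h"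
    by (simp only:)
  then show ?thesis by simp
qed

lemma q_eq_B: assumes "\<And>a. q a x = q a y" shows "x = y"
proof -
  have "bet k \<otimes> (x \<otimes> qanti B (bet k)) = bet k \<otimes> (y \<otimes> qanti B (bet k))"
    using assms by (intro p_eq_B) (simp add: q_alt)
  then have "bet h \<otimes> (bet k \<otimes> (x \<otimes> qanti B (bet k))) \<otimes> qanti B (bet h)
      = bet h \<otimes> (bet k \<otimes> (y \<otimes> qanti B (bet k))) \<otimes> qanti B (bet h)"
    by (simp only:)
  then show ?thesis by simp
qed

lemma q_mul_B: "q a (b \<otimes> c) = ptens q (qcomul A.H a) (tens b c)"
  unfolding ptens_tens_right[OF q_bilin] unfolding q_def
  by (rule A.deform_pairing[where p = p and bc = "b \<otimes> c", OF p_bilin p_mul_B, symmetric])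

lemma q_mul_A: "q (a \<odot> a') b = ptens q (tens a a') (qcomul B'.H b)"
proof -
  have "bilin (\<lambda>b a. p a b)" using p_bilin by (simp add: bilin_def)
  then show ?thesis
    unfolding ptens_tens_left[OF q_bilin] q_alt
    by (rule B'.deform_pairing[where p = "\<lambda>b a. p a b" and bc = "a \<odot> a'", OF _ p_mul_A, symmetric])
qed

text \<open>All factors around the antipode of b are transposed to A and \<open>p_anti\<close>
  carries S across; what remains is an identity between products of k, h and S(k).\<close>

lemma q_anti: "q (qanti A.H a) b = q a (qanti B'.H b)"
proof -
  note At = A.k_At A.h_At
  \<comment> \<open>The factors are bracketed to the left so that the transposition rules can peel
    them off one by one from the right.\<close>
  have "p c (x \<otimes> (bet h \<otimes> (qanti B (bet k) \<otimes> qanti B (bet k))))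
      = p c (x \<otimes> bet h \<otimes> qanti B (bet k) \<otimes> qanti B (bet k))" for c x
    by simp
  also have "\<dots> c x = p (qanti A h \<odot> (c \<odot> qanti A k \<odot> qanti A k)) x" for c x
    by (simp only: p_S_bet_right[OF A.k_At A.S_S_k] p_bet_right[OF A.h_At])
  finally have right: "p c (x \<otimes> (bet h \<otimes> (qanti B (bet k) \<otimes> qanti B (bet k))))
      = p (qanti A h \<odot> (c \<odot> qanti A k \<odot> qanti A k)) x" for c x .
  have "q a (qanti B'.H b) = p a (bet k \<otimes> (qanti B (bet h) \<otimes> (bet k \<otimes>
      (qanti B b \<otimes> (bet h \<otimes> (qanti B (bet k) \<otimes> qanti B (bet k)))))))"
    by (simp only: q_alt B'.deform_simps B.assoc)
  also have "\<dots> = p (qanti A (qanti A h \<odot> (k \<odot> (k \<odot> a \<odot> h) \<odot> qanti A k \<odot> qanti A k))) b"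
    by (simp only: p_bet_left[OF A.k_At] p_S_bet_left[OF A.h_At] right p_anti)
  also have "\<dots> = q (qanti A.H a) b"
    by (simp add: q_def A.deform_simps A.S_mul)
  finally show ?thesis by simp
qed

text \<open>The deforming factors are self-adjoint, so the k and S(k) of the pairing cancel the h
  and S(h) of the deformed antipode.\<close>

lemma q_star: "q a (qstar B b) = cnj (q (qstar A (qanti A.H a)) b)"
  by (simp add: q_def p_star A.deform_simps A.S_mul A.star_mul A.k_star A.h_star A.star_S_k A.star_S_h)

lemma dual_pair_deform: "dual_pair A.H B'.H q"
proof -
  have zero: "q vzero b = 0" "q a vzero = 0" for a b
    using lin_fun_smul[of "\<lambda>x. q x b" 0 vzero] lin_fun_smul[of "q a" 0 vzero] q_bilin
    by (simp_all add: bilin_def smul_def vzero_def)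
  show ?thesis
    unfolding dual_pair_def A.deform_simps(1-3) B'.deform_simps(1-3)
  proof (intro conjI allI impI)
    fix a assume "\<forall>b. q a b = 0"
    then show "a = vzero" by (intro q_eq_A) (simp add: zero)
  next
    fix b assume "\<forall>a. q a b = 0"
    then show "b = vzero" by (intro q_eq_B) (simp add: zero)
  next
    fix a show "q a (qunit B) = qcounit A.H a"
      by (simp add: q_def p_one_B A.deform_simps)
  next
    fix b show "q (qunit A) b = qcounit B'.H b"
      by (simp add: q_alt p_one_A B'.deform_simps)
  qed (rule q_mul_B q_mul_A q_anti q_star | use q_bilin in \<open>simp add: bilin_def\<close>)+
qed

text \<open>Existence is \<open>q_mul_B\<close> and the unit rule; uniqueness is the nondegeneracy
  of the deformed pairing on the tensor square.\<close>

lemma comul_counit_unique: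
  "((\<forall>a b c. ptens q (D a) (tens b c) = q a (b \<otimes> c)) \<and> (\<forall>a. E a = q a (qunit B)))
     \<longleftrightarrow> D = qcomul A.H \<and> E = qcounit A.H"
proof (intro iffI conjI allI)
  assume *: "(\<forall>a b c. ptens q (D a) (tens b c) = q a (b \<otimes> c)) \<and> (\<forall>a. E a = q a (qunit B))"
  show "D = qcomul A.H"
    using * by (intro ext[of D] ptens_nondegenerate[OF q_bilin q_eq_A]) (simp_all add: q_mul_B)
  show "E = qcounit A.H"
    using * by (simp add: fun_eq_iff q_def p_one_B A.deform_simps)
next
  assume *: "D = qcomul A.H \<and> E = qcounit A.H"
  show "ptens q (D a) (tens b c) = q a (b \<otimes> c)" for a b c
    using * by (simp add: q_mul_B)
  show "E a = q a (qunit B)" for a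
    using * by (simp add: q_def p_one_B A.deform_simps)
qed

lemmas comul_counit_unique_unfolded = comul_counit_unique[unfolded q_def[abs_def]]

lemma regular_dual_pair:
  "\<exists>\<Delta>A \<epsilon>A SA \<Delta>B \<epsilon>B SB r.
     fin_cqg (A\<lparr>qcomul := \<Delta>A, qcounit := \<epsilon>A, qanti := SA\<rparr>) \<and>
     regular (A\<lparr>qcomul := \<Delta>A, qcounit := \<epsilon>A, qanti := SA\<rparr>) \<and>
     fin_cqg (B\<lparr>qcomul := \<Delta>B, qcounit := \<epsilon>B, qanti := SB\<rparr>) \<and>
     regular (B\<lparr>qcomul := \<Delta>B, qcounit := \<epsilon>B, qanti := SB\<rparr>) \<and>
     dual_pair (A\<lparr>qcomul := \<Delta>A, qcounit := \<epsilon>A, qanti := SA\<rparr>)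
               (B\<lparr>qcomul := \<Delta>B, qcounit := \<epsilon>B, qanti := SB\<rparr>) r"
proof -
  \<comment> \<open>A deformation updates only coproduct, counit and antipode, so this record form
    shows that the algebra is unchanged.\<close>
  obtain D E T where A': "A.H = A\<lparr>qcomul := D, qcounit := E, qanti := T\<rparr>"
    unfolding deform_def Let_def by blast
  obtain D' E' T' where B': "B'.H = B\<lparr>qcomul := D', qcounit := E', qanti := T'\<rparr>"
    unfolding deform_def Let_def by blast
  show ?thesis
    using A.fin_cqg_deform A.regular_deform B'.fin_cqg_deform B'.regular_deform dual_pair_deform
    unfolding A' B' by (intro exI conjI)
qed

end

theorem theorem7p3:
  fixes A :: "('i::finite) qgroupoid" and k kinv :: "'i vec"
  assumes qg: "fin_cqg A"
    and k_t: "k \<in> range (eps_t A)"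
    and k_pos: "positive A k"
    and k_inv: "qmul A k kinv = qunit A" "qmul A kinv k = qunit A"
    and k_sq: "qmul A k k = tm (qmul A) (flip (tmap (qanti A) id (qcomul A (qunit A))))"
  shows "fin_cqg (deform A k kinv) \<and> regular (deform A k kinv) \<and>
    (\<forall>a. qcounit A (qmul A k (qmul A a (qanti A k))) = qcounit A (qmul A (qanti A k) (qmul A a k))) \<and>
    (\<forall>(B :: ('j::finite) qgroupoid) p. fin_cqg B \<and> dual_pair A B p \<longrightarrow>
       (let q = (\<lambda>a b. p (qmul A k (qmul A a (qanti A k))) b) in
         (\<forall>\<Delta>' \<epsilon>'. ((\<forall>a b c. ptens q (\<Delta>' a) (tens b c) = q a (qmul B b c)) \<and>
                   (\<forall>a. \<epsilon>' a = q a (qunit B)))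
             \<longleftrightarrow> (\<Delta>' = qcomul (deform A k kinv) \<and> \<epsilon>' = qcounit (deform A k kinv)))) \<and>
       (\<exists>\<Delta>A \<epsilon>A SA \<Delta>B \<epsilon>B SB r.
          fin_cqg (A\<lparr>qcomul := \<Delta>A, qcounit := \<epsilon>A, qanti := SA\<rparr>) \<and>
          regular (A\<lparr>qcomul := \<Delta>A, qcounit := \<epsilon>A, qanti := SA\<rparr>) \<and>
          fin_cqg (B\<lparr>qcomul := \<Delta>B, qcounit := \<epsilon>B, qanti := SB\<rparr>) \<and>
          regular (B\<lparr>qcomul := \<Delta>B, qcounit := \<epsilon>B, qanti := SB\<rparr>) \<and>
          dual_pair (A\<lparr>qcomul := \<Delta>A, qcounit := \<epsilon>A, qanti := SA\<rparr>)
                    (B\<lparr>qcomul := \<Delta>B, qcounit := \<epsilon>B, qanti := SB\<rparr>) r))"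
proof -
  interpret A0: qg A by unfold_locales (rule qg)
  interpret A: qgk A k kinv
  proof
    obtain y where "k = qmul A (qstar A y) y" using k_pos by (auto simp: positive_def)
    then show "qstar A k = k" by (simp add: A0.star_mul)
  qed (use k_t k_inv k_sq in auto)
  have qp: "qpair A k kinv B p" if "fin_cqg B \<and> dual_pair A B p" for B :: "'j qgroupoid" and p
    by unfold_locales (use that in auto)
  show ?thesis
    unfolding Let_def
    by (intro conjI allI impI A.fin_cqg_deform A.regular_deform A.deform_eps_eq
      qpair.comul_counit_unique_unfolded[OF qp]
      qpair.regular_dual_pair[OF qp]; (erule conjunct1 | erule conjunct2))
qed

end
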